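(* Let $\mathrm{H}_1(x,y,z)=\mathrm{F}_{D}^{(3)}\left(\tfrac12;\tfrac12;2\,\middle|\,x,y,z\right)$ and $\mathrm{G}(x,y,z)=\mathrm{F}_{D}^{(3)}\left(\tfrac12;\tfrac12;1\,\middle|\,x,y,z\right)$. Then the identity $\mathrm{H}_1(x,y,z)=R\,\mathrm{G}(x,y,z)$ holds for $x=\tfrac12$ and each of the following choices of $(y,z,R)$: 1. (order 3) $y=\frac14$, $z=-\frac12$, $R=2\sqrt3\,(2-\sqrt3)$; 2. (order 5) $y=\frac{3-\sqrt5}{2}$, $z=-\frac{1+\sqrt5}{2}$, $R=2\sqrt{\sqrt5-2}$; 3. (order 7) $y=\frac{7}{16}$, $z=-\frac72$, $R=\frac{2(4-\sqrt7)}{\sqrt7}$; 4. (order 9) $y=2\sqrt3-3$, $z=-(2\sqrt3+3)$, $R=\frac{\sqrt2}{\sqrt[4]{3}}$; 5. (order 13) $y=\frac{19-5\sqrt{13}}{2}$, $z=-\frac{17+5\sqrt{13}}{2}$, $R=\frac{2\sqrt{37\sqrt{13}-106}}{9}$; 6. (order 15) $y=\frac{3}{32}(3+\sqrt5)$, $z=-\frac32(9+4\sqrt5)$, $R=\frac{2(\sqrt3-3\sqrt5)(\sqrt5-4)}{3(1+\sqrt{15})}$; 7. (order 25) $y=4(9\sqrt5-20)$, $z=-4(20+9\sqrt5)$, $R=\frac{2}{\sqrt[4]{5}}$; 8. (order 33) $y=\frac{16}{16+15\sqrt3-3\sqrt{11}}$, $z=\frac{16}{16-15\sqrt3+3\sqrt{11}}$,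 $R=\frac{\sqrt3\,(17-\sqrt{33})\sqrt[4]{43-5\sqrt{33}}}{2^{19/4}}$.
   Context: Lauricella function with equal $b$-parameters: for real $\alpha,\beta,\gamma$ with $\gamma>\alpha>0$ and $x_1,x_2,x_3\in\mathbb{C}\setminus[1,\infty)$, $\mathrm{F}_{D}^{(3)}(\alpha;\beta;\gamma\,|\,x_1,x_2,x_3)$ denotes the Lauricella function with parameters $b_1=b_2=b_3=\beta$, given by the integral representation $$\mathrm{F}_{D}^{(3)}(\alpha;\beta;\gamma\,|\,x_1,x_2,x_3)=\frac{\Gamma(\gamma)}{\Gamma(\alpha)\Gamma(\gamma-\alpha)}\int_0^1\frac{u^{\alpha-1}(1-u)^{\gamma-\alpha-1}}{(1-x_1u)^{\beta}(1-x_2u)^{\beta}(1-x_3u)^{\beta}}\,\mathrm{d}u$$ (principal branches). It is the analytic continuation of the series $\sum_{m_1,m_2,m_3\ge0}\frac{(\alpha)_{m_1+m_2+m_3}(\beta)_{m_1}(\beta)_{m_2}(\beta)_{m_3}}{(\gamma)_{m_1+m_2+m_3}\,m_1!\,m_2!\,m_3!}x_1^{m_1}x_2^{m_2}x_3^{m_3}$, which converges for $|x_j|<1$, where $(\lambda)_m=\lambda(\lambda+1)\cdots(\lambda+m-1)$. The "order" attached to each case is only a label (it is the integer $n$ of the $n$-th elliptic singular modulus). *)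

theory Defs
  imports "HOL-Analysis.Analysis"
begin

(* The Lauricella function F_D of three variables with b_1 = b_2 = b_3 = \<beta>, given by its
   Euler integral.  It is meaningful for \<gamma> > \<alpha> > 0 and x1, x2, x3 outside [1,\<infinity>): the
   integral then converges absolutely, and no 1 - x_j u (0 \<le> u \<le> 1) lies on the cut of the
   principal branch taken by complex powr.  Since 0 powr a = 0, the integrand is 0 at an
   endpoint where it would be singular, which does not affect the integral. *)
definition Lauricella_FD3 ::
  "real \<Rightarrow> real \<Rightarrow> real \<Rightarrow> complex \<Rightarrow> complex \<Rightarrow> complex \<Rightarrow> complex" where
  "Lauricella_FD3 \<alpha> \<beta> \<gamma> x1 x2 x3 =
     complex_of_real (Gamma \<gamma> / (Gamma \<alpha> * Gamma (\<gamma> - \<alpha>))) *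
     integral {0..1} (\<lambda>u::real.
       complex_of_real (u powr (\<alpha> - 1) * (1 - u) powr (\<gamma> - \<alpha> - 1)) /
       ((1 - x1 * complex_of_real u) powr complex_of_real \<beta> *
        (1 - x2 * complex_of_real u) powr complex_of_real \<beta> *
        (1 - x3 * complex_of_real u) powr complex_of_real \<beta>))"

definition Lauricella_H1 :: "complex \<Rightarrow> complex \<Rightarrow> complex \<Rightarrow> complex" where
  "Lauricella_H1 x y z = Lauricella_FD3 (1/2) (1/2) 2 x y z"

definition Lauricella_G :: "complex \<Rightarrow> complex \<Rightarrow> complex \<Rightarrow> complex" where
  "Lauricella_G x y z = Lauricella_FD3 (1/2) (1/2) 1 x y z"

end

(* In all cases 1/y + 1/z = 2. With a = 1/y - 1 and t = 1 - u, both Euler integrals become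
   integrals over 0 < t < 1 on the genus 2 curve w^2 = t (1 - t^2) (a^2 - t^2), with
   differentials dt/w and t dt/w. This curve covers the two elliptic curves
   E(+-): Y^2 = x (x^2 +- 4 sqrt a x - (a - 1)^2) by x = (sqrt a -+ t)^2 / t, and
   sqrt a dt/w +- t dt/w is the pullback of dx/Y. So the theorem says that the real periods
   of E(+) and E(-) have ratio sqrt n, where n is the order. These curves are quadratic
   twists of each other by -1, so the ratio amounts to complex multiplication by sqrt (-n),
   which is a real isogeny of degree n from E(-) to E(+). It has the form
   x -> x P(x)^2 / Q(x)^2 and is given explicitly below, for n = 9, 15, 25, 33 as a composition
   of two isogenies. *)
theory Submission
  imports Defs "HOL-Computational_Algebra.Polynomial"
begin

section \<open>Real periods of elliptic curves\<close>

text \<open>The obstacle is to read off a ratio of periods from an isogeny without lattices or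
  complex integration. A real change of variables suffices: the isogeny has no kernel point on the
  real branch to the right of the positive root, so it maps this branch increasingly onto that of
  the other curve and multiplies dx/Y by a constant. The polynomials \<open>P\<close>,
  \<open>Q\<close>, \<open>W\<close> come from the group law. The zeros of \<open>Q\<close> are the
  x-coordinates of the nonzero kernel points. Those of \<open>P\<close> and \<open>W\<close> belong
  to the points sent to (0,0) and to the other two points of order 2, leaving out the points of
  order 2 themselves. Translation by (0,0) is x -> b/x, so \<open>P\<close> is x^m Q(b/x) up to a
  constant factor, where m is the degree of \<open>Q\<close> and 2m + 1 that of the isogeny.\<close>

definition ell_root :: "real \<Rightarrow> real \<Rightarrow> real" where
  "ell_root a b = (- a + sqrt (a\<^sup>2 - 4 * b)) / 2"

definition ell_integrand :: "real \<Rightarrow> real \<Rightarrow> real \<Rightarrow> real" where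
  "ell_integrand a b x = 1 / sqrt (x * (x\<^sup>2 + a * x + b))"

text \<open>Half the real period of the curve \<open>Y\<^sup>2 = x (x\<^sup>2 + a x + b)\<close>. This reading needs \<open>b < 0\<close>,
  which makes \<open>ell_root a b\<close> the only positive root of the cubic.\<close>

definition has_ell_period :: "real \<Rightarrow> real \<Rightarrow> real \<Rightarrow> bool" where
  "has_ell_period a b I \<longleftrightarrow>
     ell_integrand a b absolutely_integrable_on {ell_root a b<..} \<and>
     integral {ell_root a b<..} (ell_integrand a b) = I"

lemma ell_quadratic_factor:
  assumes "b < 0"
  shows "x\<^sup>2 + a * x + b = (x - ell_root a b) * (x + a + ell_root a b)"
proof -
  define s where "s = sqrt (a\<^sup>2 - 4 * b)"
  have "s * s = a\<^sup>2 - 4 * b"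
  proof -
    have "0 \<le> a\<^sup>2 - 4 * b" using assms zero_le_power2[of a] by linarith
    then show ?thesis by (simp add: s_def)
  qed
  then have "b = (a * a - s * s) / 4"
    by (simp add: power2_eq_square)
  then show ?thesis
    unfolding ell_root_def s_def[symmetric] by (simp add: field_simps power2_eq_square)
qed

text \<open>The other root of the quadratic is \<open>- a - ell_root a b\<close>, which is negative
  because the product of the roots is \<open>b < 0\<close>. Hence a nonnegative number can be
  compared with \<open>ell_root a b\<close> through the sign of the quadratic alone, without
  touching the square root.\<close>

lemma ell_conjugate_pos:
  assumes "b < 0" "0 \<le> x"
  shows "0 < x + a + ell_root a b"
proof -
  have "\<bar>a\<bar> < sqrt (a\<^sup>2 - 4 * b)"
    using assms by (intro real_less_rsqrt) simp
  then have "0 < a + ell_root a b"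
    by (simp add: ell_root_def abs_less_iff field_simps)
  then show ?thesis using assms(2) by simp
qed

lemma ell_root_gt_iff:
  "b < 0 \<Longrightarrow> 0 \<le> x \<Longrightarrow> ell_root a b < x \<longleftrightarrow> 0 < x\<^sup>2 + a * x + b"
  using ell_conjugate_pos[of b x a] by (simp add: ell_quadratic_factor zero_less_mult_iff)

lemma ell_root_eq_iff:
  "b < 0 \<Longrightarrow> 0 \<le> x \<Longrightarrow> x = ell_root a b \<longleftrightarrow> x\<^sup>2 + a * x + b = 0"
  using ell_conjugate_pos[of b x a] by (auto simp add: ell_quadratic_factor)

lemma ell_root_zero: "b < 0 \<Longrightarrow> (ell_root a b)\<^sup>2 + a * ell_root a b + b = 0"
  by (simp add: ell_quadratic_factor)

text \<open>\<open>S\<close> is an interval that is open at its left end \<open>l\<close>. Its right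
  end is left free because the lemma serves both for the covering by the genus 2 curve, where
  \<open>S\<close> is \<open>{0<..<1}\<close>, and for isogenies, where \<open>S\<close> is a
  half-line. Only continuity is required at \<open>l\<close>, the point that goes to the
  root.\<close>

lemma has_ell_period_substitution:
  assumes "S \<in> sets lebesgue"
    and der: "\<And>x. x \<in> S \<Longrightarrow> (g has_field_derivative g' x) (at x)"
    and pos: "\<And>x. x \<in> S \<Longrightarrow> 0 < g' x"
    and eq: "\<And>x. x \<in> S \<Longrightarrow> g' x * ell_integrand a b (g x) = h x"
    and cont: "continuous_on (insert l S) g"
    and left: "g l = ell_root a b"
    and S: "\<And>x. x \<in> S \<Longrightarrow> l < x" "\<And>x. x \<in> S \<Longrightarrow> {l<..x} \<subseteq> S"
    and unbounded: "\<And>y. \<exists>x\<in>S. y < g x"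
  shows "has_ell_period a b I \<longleftrightarrow> h absolutely_integrable_on S \<and> integral S h = I"
proof -
  \<comment> \<open>Allowing \<open>x = l\<close> yields at once the injectivity on \<open>S\<close>
    and the bound \<open>ell_root a b < g x\<close>.\<close>
  have mono: "g x < g y" if "x \<in> insert l S" "y \<in> S" "x < y" for x y
  proof (rule DERIV_pos_imp_increasing_open[OF \<open>x < y\<close>])
    show "\<exists>d. (g has_real_derivative d) (at z) \<and> 0 < d" if "x < z" "z < y" for z
    proof -
      have "z \<in> {l<..y}"
        using that \<open>x \<in> insert l S\<close> S(1) by fastforce
      then have "z \<in> S" using S(2) \<open>y \<in> S\<close> by blast
      then show ?thesis using der pos by blast
    qed
    have "{x..y} \<subseteq> insert l S"
    proof
      fix z assume z: "z \<in> {x..y}"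
      have "l \<le> x" using S(1) \<open>x \<in> insert l S\<close> by force
      then have "z = l \<or> z \<in> {l<..y}" using z by auto
      then show "z \<in> insert l S" using S(2)[OF \<open>y \<in> S\<close>] by blast
    qed
    then show "continuous_on {x..y} g"
      using cont continuous_on_subset by blast
  qed
  have inj: "inj_on g S"
    using mono by (intro linorder_inj_onI') (metis insertCI less_irrefl)
  have "g ` S = {ell_root a b<..}"
  proof (intro equalityI subsetI)
    show "y \<in> {ell_root a b<..}" if "y \<in> g ` S" for y
      using mono left S(1) that by fastforce
    show "y \<in> g ` S" if y: "y \<in> {ell_root a b<..}" for y
    proof -
      obtain x where x: "x \<in> S" "y < g x" using unbounded by blast
      have "{l..x} \<subseteq> insert l S" using S(2)[OF x(1)] by force
      then have "continuous_on {l..x} g"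
        using cont continuous_on_subset by blast
      with x y left S(1)[OF x(1)] obtain z where z: "l \<le> z" "z \<le> x" "g z = y"
        using IVT'[of g l y x] by auto
      with y left have "z \<in> {l<..x}" by (cases "z = l") auto
      then show ?thesis using S(2)[OF x(1)] z by blast
    qed
  qed
  moreover have eq': "\<bar>g' x\<bar> * ell_integrand a b (g x) = h x" if "x \<in> S" for x
    using eq[OF that] pos[OF that] by simp
  then have "(\<lambda>x. \<bar>g' x\<bar> * ell_integrand a b (g x)) absolutely_integrable_on S \<longleftrightarrow>
      h absolutely_integrable_on S"
    by (intro set_integrable_cong) auto
  moreover have "integral S (\<lambda>x. \<bar>g' x\<bar> * ell_integrand a b (g x)) = integral S h"
    by (intro Henstock_Kurzweil_Integration.integral_cong eq')
  ultimately show ?thesis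
    using has_absolute_integral_change_of_variables_1'[OF assms(1) _ inj,
        of g' "ell_integrand a b" I] der
    by (simp add: has_ell_period_def has_field_derivative_at_within)
qed

text \<open>Substituting \<open>l * x\<close> brings in \<open>l\<close> from the differential and
  \<open>l * sqrt l\<close> in the denominator. This moves a curve to a model over a smaller field,
  and it supplies square roots that lie outside the field of the coefficients.\<close>

lemma has_ell_period_scale:
  assumes l: "0 < l" and b: "b < 0"
  shows "has_ell_period (l * a) (l\<^sup>2 * b) I \<longleftrightarrow> has_ell_period a b (sqrt l * I)"
proof -
  have root: "ell_root (l * a) (l\<^sup>2 * b) = l * ell_root a b"
  proof -
    have "(l * a)\<^sup>2 - 4 * (l\<^sup>2 * b) = l\<^sup>2 * (a\<^sup>2 - 4 * b)"
      by (simp add: algebra_simps power2_eq_square)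
    then have "sqrt ((l * a)\<^sup>2 - 4 * (l\<^sup>2 * b)) = l * sqrt (a\<^sup>2 - 4 * b)"
      using l by (simp add: real_sqrt_mult)
    then show ?thesis
      by (simp add: ell_root_def algebra_simps)
  qed
  let ?r = "ell_root a b"
  have "has_ell_period (l * a) (l\<^sup>2 * b) I \<longleftrightarrow>
      (\<lambda>x. ell_integrand a b x / sqrt l) absolutely_integrable_on {?r<..} \<and>
      integral {?r<..} (\<lambda>x. ell_integrand a b x / sqrt l) = I"
  proof (rule has_ell_period_substitution[where g = "\<lambda>x. l * x" and g' = "\<lambda>_. l" and l = ?r])
    show "l * ell_integrand (l * a) (l\<^sup>2 * b) (l * x) = ell_integrand a b x / sqrt l"
      for x
    proof -
      have "l * x * ((l * x)\<^sup>2 + l * a * (l * x) + l\<^sup>2 * b) = l\<^sup>2 * (l * (x * (x\<^sup>2 + a * x + b)))"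
        by (simp add: algebra_simps power2_eq_square)
      then have "sqrt (l * x * ((l * x)\<^sup>2 + l * a * (l * x) + l\<^sup>2 * b)) =
          sqrt (l\<^sup>2) * (sqrt l * sqrt (x * (x\<^sup>2 + a * x + b)))"
        by (simp only: real_sqrt_mult)
      then show ?thesis
        using l by (simp add: ell_integrand_def)
    qed
    show "\<exists>x\<in>{?r<..}. y < l * x" for y
      using l by (intro bexI[of _ "max (?r + 1) (y / l + 1)"]) (auto simp: field_simps max_def)
  qed (use l root in \<open>auto intro!: derivative_eq_intros continuous_intros\<close>)
  also have "\<dots> \<longleftrightarrow> has_ell_period a b (sqrt l * I)"
    using l set_integrable_mult_right_iff[of "1 / sqrt l" lebesgue "{?r<..}" "ell_integrand a b"]
    by (auto simp: has_ell_period_def field_simps)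
  finally show ?thesis .
qed

section \<open>Isogenies\<close>

lemma poly_ratio_tendsto:
  fixes P Q :: "real poly"
  assumes "degree P = degree Q" "lead_coeff Q \<noteq> 0"
  shows "((\<lambda>x. poly P x / poly Q x) \<longlongrightarrow> lead_coeff P / lead_coeff Q) at_top"
proof -
  have "((\<lambda>x. (poly P x / x ^ degree P) / (poly Q x / x ^ degree Q)) \<longlongrightarrow>
      lead_coeff P / lead_coeff Q) at_infinity"
    using poly_divide_tendsto_aux[of P] poly_divide_tendsto_aux[of Q] assms
    by (intro tendsto_divide) auto
  then have "((\<lambda>x. (poly P x / x ^ degree P) / (poly Q x / x ^ degree Q)) \<longlongrightarrow>
      lead_coeff P / lead_coeff Q) at_top"
    using at_top_le_at_infinity tendsto_mono by blast
  moreover have "eventually (\<lambda>x::real. (poly P x / x ^ degree P) / (poly Q x / x ^ degree Q)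
      = poly P x / poly Q x) at_top"
    using eventually_gt_at_top[of 0] by eventually_elim (simp add: assms)
  ultimately show ?thesis
    using tendsto_cong by fastforce
qed

text \<open>With an inductive predicate, its introduction rules let the simplifier reduce positivity
  of an explicit polynomial to the signs of its single coefficients.\<close>

inductive pos_coeffs :: "real poly \<Rightarrow> bool" where
  const: "0 < a \<Longrightarrow> pos_coeffs [:a:]"
| pCons: "0 < a \<Longrightarrow> pos_coeffs p \<Longrightarrow> pos_coeffs (pCons a p)"

lemma pos_coeffs_imp_poly_pos: "pos_coeffs p \<Longrightarrow> 0 < x \<Longrightarrow> 0 < poly p x"
  by (induction rule: pos_coeffs.induct) (auto intro: add_pos_pos)

text \<open>Positive Taylor coefficients at \<open>c\<close> exclude zeros beyond \<open>c\<close>,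
  so no root of \<open>p\<close> has to be located.\<close>

lemma pos_coeffs_shift_imp_poly_pos:
  assumes "pos_coeffs (pcompose p [:c, 1:])" "c < x"
  shows "0 < poly p x"
  using pos_coeffs_imp_poly_pos[OF assms(1), of "x - c"] assms(2) by (simp add: poly_pcompose)

text \<open>The isogeny is \<open>\<phi> x = x (P x / Q x)\<^sup>2\<close>, and \<open>W\<close> is determined by \<open>\<phi>' = k P W / Q\<^sup>3\<close>. Then \<open>curve\<close>
  says that \<open>\<phi>\<close> multiplies the invariant differential by \<open>k\<close>. The number \<open>c\<close> separates the
  positive root of \<open>x\<^sup>2 + a x + b\<close> from the real zeros of \<open>P\<close> and \<open>W\<close>, all of which are
  smaller.\<close>

lemma has_ell_period_isogeny:
  fixes P Q W :: "real poly"
  assumes W: "smult k W = P * Q + [:0, 2:] * (pderiv P * Q - P * pderiv Q)"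
    and curve: "[:0, 1:] * P\<^sup>2 * ([:0, 1:] * P\<^sup>2 + smult A (Q\<^sup>2)) + smult B ((Q\<^sup>2)\<^sup>2)
      = [:b, a, 1:] * W\<^sup>2"
    and deg: "degree P = degree Q" "0 < lead_coeff P" "0 < lead_coeff Q"
    and sgn: "b < 0" "B < 0" "0 < k"
    and c: "0 \<le> c" "poly [:b, a, 1:] c < 0"
    and shift: "pos_coeffs (pcompose P [:c, 1:])" "pos_coeffs Q" "pos_coeffs (pcompose W [:c, 1:])"
    and period: "has_ell_period a b I"
  shows "has_ell_period A B (k * I)"
proof -
  note b = sgn(1) and B = sgn(2) and k = sgn(3)
  have pos: "0 < poly P x" "0 < poly Q x" "0 < poly W x" if "c < x" for x
    using pos_coeffs_shift_imp_poly_pos[OF shift(1) that]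
      pos_coeffs_shift_imp_poly_pos[OF shift(3) that]
      pos_coeffs_imp_poly_pos[OF shift(2)] c(1) that by auto
  have W': "poly P x * poly Q x + 2 * x * (poly (pderiv P) x * poly Q x - poly P x * poly (pderiv Q) x)
      = k * poly W x" for x
    using arg_cong[OF W, of "\<lambda>p. poly p x"] by (simp add: algebra_simps)
  have curve': "x * poly P x ^ 2 * (x * poly P x ^ 2 + A * poly Q x ^ 2) + B * (poly Q x ^ 2) ^ 2
      = (x\<^sup>2 + a * x + b) * poly W x ^ 2" for x
    using arg_cong[OF curve, of "\<lambda>p. poly p x"] by (simp add: algebra_simps power2_eq_square)
  define g where "g x = x * (poly P x / poly Q x)\<^sup>2" for x
  define g' where "g' x = k * (poly P x * poly W x / poly Q x ^ 3)" for x
  let ?r = "ell_root a b"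
  have cr: "c < ?r"
  proof -
    have "c\<^sup>2 + a * c + b < 0" using c(2) by (simp add: algebra_simps power2_eq_square)
    then have "\<not> ell_root a b < c" "c \<noteq> ell_root a b"
      using ell_root_gt_iff[OF b c(1), of a] ell_root_zero[OF b, of a] by auto
    then show ?thesis by simp
  qed
  have gpos: "0 < g x" if "c < x" for x
    using that pos(1,2)[OF that] c(1) by (auto simp: g_def)
  have quad: "(g x)\<^sup>2 + A * g x + B = (x\<^sup>2 + a * x + b) * (poly W x)\<^sup>2 / poly Q x ^ 4" if "c < x" for x
  proof -
    have "((g x)\<^sup>2 + A * g x + B) * poly Q x ^ 4 = (x\<^sup>2 + a * x + b) * poly W x ^ 2"
      using pos(2)[OF that] unfolding curve'[of x, symmetric] g_def
      by (simp add: field_simps power2_eq_square power4_eq_xxxx)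
    then show ?thesis
      using pos(2)[OF that] by (simp add: nonzero_eq_divide_eq)
  qed
  have der: "(g has_field_derivative g' x) (at x)" if "c < x" for x
  proof -
    have g': "g' x = poly P x * (poly P x * poly Q x +
        2 * x * (poly (pderiv P) x * poly Q x - poly P x * poly (pderiv Q) x)) / poly Q x ^ 3"
      unfolding W' g'_def by simp
    show ?thesis
      unfolding g' unfolding g_def using pos(2)[OF that]
      by (auto intro!: derivative_eq_intros simp: field_simps power2_eq_square power3_eq_cube)
  qed
  have "has_ell_period A B (k * I) \<longleftrightarrow>
      (\<lambda>x. k * ell_integrand a b x) absolutely_integrable_on {?r<..} \<and>
      integral {?r<..} (\<lambda>x. k * ell_integrand a b x) = k * I"
  proof (rule has_ell_period_substitution[where g = g and g' = g' and l = ?r])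
    show "(g has_field_derivative g' x) (at x)" if "x \<in> {?r<..}" for x
      using der cr that by simp
    show "0 < g' x" if "x \<in> {?r<..}" for x
      using pos cr k that by (simp add: g'_def)
    show "g' x * ell_integrand A B (g x) = k * ell_integrand a b x" if "x \<in> {?r<..}" for x
    proof -
      have x: "c < x" using that cr by simp
      define v where "v = poly P x * poly W x / poly Q x ^ 3"
      have v: "0 < v" using pos[OF x] by (simp add: v_def)
      \<comment> \<open>Since \<open>g' x\<close> is \<open>k * v\<close>, this is the invariance of
        the differential up to \<open>k\<close>, in squared form. Positivity of \<open>v\<close>
        fixes the sign of the square root.\<close>
      have "g x * ((g x)\<^sup>2 + A * g x + B) = x * (x\<^sup>2 + a * x + b) * v\<^sup>2"
        using pos(2)[OF x]
        by (subst quad[OF x])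
          (simp add: g_def v_def field_simps power2_eq_square power3_eq_cube power4_eq_xxxx)
      then have "sqrt (g x * ((g x)\<^sup>2 + A * g x + B)) = sqrt (x * (x\<^sup>2 + a * x + b)) * v"
        using v by (simp add: real_sqrt_mult)
      then show ?thesis
        using v by (simp add: ell_integrand_def g'_def flip: v_def)
    qed
    have "isCont g x" if "?r \<le> x" for x
      using DERIV_isCont[OF der] cr that by simp
    then show "continuous_on (insert ?r {?r<..}) g"
      by (intro continuous_at_imp_continuous_on) auto
    show "g ?r = ell_root A B"
      using gpos[OF cr] quad[OF cr] ell_root_zero[OF b, of a] B
      by (intro iffD2[OF ell_root_eq_iff]) auto
    show "\<exists>x\<in>{?r<..}. y < g x" for y
    proof -
      \<comment> \<open>As \<open>P\<close> and \<open>Q\<close> have equal degree,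
        \<open>g x\<close> grows like \<open>x\<close> times the square of the ratio of their
        leading coefficients.\<close>
      have "filterlim g at_top at_top"
        unfolding g_def mult.commute[of _ "(_)\<^sup>2"]
        using poly_ratio_tendsto[OF deg(1) less_imp_neq[OF deg(3), symmetric]] deg
        by (intro filterlim_tendsto_pos_mult_at_top[where c = "(lead_coeff P / lead_coeff Q)\<^sup>2"]
            tendsto_power filterlim_ident) auto
      then have "eventually (\<lambda>x. y < g x) at_top"
        by (simp add: filterlim_at_top_dense)
      then have "eventually (\<lambda>x. y < g x \<and> ?r < x) at_top"
        using eventually_gt_at_top by (intro eventually_conj)
      then show ?thesis
        using eventually_happens'[OF trivial_limit_at_top_linorder] by fastforce
    qed
  qed auto
  then show ?thesis
    using period k by (simp add: has_ell_period_def set_integrable_mult_right_iff)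
qed

lemma has_ell_period_unique: "has_ell_period a b I \<Longrightarrow> has_ell_period a b J \<Longrightarrow> I = J"
  by (simp add: has_ell_period_def)

section \<open>Reduction of the Lauricella functions to periods\<close>

text \<open>For real arguments with all three factors positive, the principal powers are real square
  roots. The endpoints form a null set, so the open interval may be used.\<close>

lemma Lauricella_FD3_half_eq:
  fixes x1 x2 x3 \<gamma> :: real
  defines "F \<equiv> \<lambda>u. u powr (-1/2) * (1 - u) powr (\<gamma> - 3/2) /
      sqrt ((1 - x1 * u) * (1 - x2 * u) * (1 - x3 * u))"
  assumes pos: "\<And>u. 0 < u \<Longrightarrow> u < 1 \<Longrightarrow> 0 < 1 - x1 * u \<and> 0 < 1 - x2 * u \<and> 0 < 1 - x3 * u"
    and int: "F integrable_on {0<..<1}"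
  shows "Lauricella_FD3 (1/2) (1/2) \<gamma> (of_real x1) (of_real x2) (of_real x3) =
    of_real (Gamma \<gamma> / (Gamma (1/2) * Gamma (\<gamma> - 1/2)) * integral {0<..<1} F)"
proof -
  have "integral {0..1} (\<lambda>u::real. complex_of_real (u powr (1/2 - 1) * (1 - u) powr (\<gamma> - 1/2 - 1)) /
       ((1 - of_real x1 * complex_of_real u) powr complex_of_real (1/2) *
        (1 - of_real x2 * complex_of_real u) powr complex_of_real (1/2) *
        (1 - of_real x3 * complex_of_real u) powr complex_of_real (1/2))) =
      integral {0<..<1} (of_real \<circ> F)"
    unfolding integral_open_interval_real
  proof (intro Henstock_Kurzweil_Integration.integral_cong)
    fix u :: real assume u: "u \<in> {0<..<1}"
    have "(1 - of_real x * complex_of_real u) powr complex_of_real (1/2) = of_real (sqrt (1 - x * u))"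
      if "0 < 1 - x * u" for x
    proof -
      have "(complex_of_real (1 - x * u)) powr complex_of_real (1/2) = of_real ((1 - x * u) powr (1/2))"
        using that by (intro powr_of_real) auto
      then show ?thesis
        using that by (simp add: powr_half_sqrt)
    qed
    then show "complex_of_real (u powr (1/2 - 1) * (1 - u) powr (\<gamma> - 1/2 - 1)) /
       ((1 - of_real x1 * complex_of_real u) powr complex_of_real (1/2) *
        (1 - of_real x2 * complex_of_real u) powr complex_of_real (1/2) *
        (1 - of_real x3 * complex_of_real u) powr complex_of_real (1/2)) = (of_real \<circ> F) u"
      using pos[of u] u by (simp add: F_def real_sqrt_mult)
  qed
  also have "\<dots> = of_real (integral {0<..<1} F)"
    by (rule integral_linear[OF int bounded_linear_of_real])
  finally show ?thesis
    by (simp add: Lauricella_FD3_def)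
qed

text \<open>\<open>I n\<close> belongs to \<gamma> = n + 1, whose Euler integrand contains (1 - u)^n
  in addition to the common factor; this is the t^n of the differentials. The constant
  \<open>C\<close> is the same for both curves and cancels in the ratio, so only its sign is
  recorded.\<close>

lemma ell_periods_of_Lauricella:
  fixes a :: real
  defines "y \<equiv> 1 / (1 + a)" and "z \<equiv> 1 / (1 - a)"
  assumes a: "1 < a"
  obtains C I where "0 < C"
    "Lauricella_G (1/2) (of_real y) (of_real z) = of_real (I 0)"
    "Lauricella_H1 (1/2) (of_real y) (of_real z) = of_real (2 * I 1)"
    "has_ell_period (4 * sqrt a) (- (a - 1)\<^sup>2) (C * (sqrt a * I 0 + I (1::nat)))"
    "has_ell_period (- 4 * sqrt a) (- (a - 1)\<^sup>2) (C * (sqrt a * I 0 - I 1))"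
proof -
  define h where "h u = (1 - 1/2 * u) * (1 - y * u) * (1 - z * u)" for u
  define F where "F n u = u powr (-1/2) * (1 - u) powr (real n - 1/2) / sqrt (h u)" for n :: nat and u
  define J where "J n = integral {0<..<1} (F n)" for n
  define C where "C = sqrt 2 * sqrt (a\<^sup>2 - 1)"
  let ?S = "{0<..<1::real}"
  have a2: "1 < a\<^sup>2" using a by (simp add: one_less_power)
  have C: "0 < C" using a2 by (simp add: C_def)
  have yz: "0 < 1 - y * u" "0 < 1 - z * u" if "0 \<le> u" "u \<le> 1" for u
    using a that by (simp_all add: y_def z_def field_simps)
  have hpos: "0 < h u" if "0 \<le> u" "u \<le> 1" for u
    using yz[OF that] that unfolding h_def by (intro mult_pos_pos) auto
  have hcont: "continuous_on {0..1} (\<lambda>u. 1 / sqrt (h u))"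
    using hpos unfolding h_def
    by (intro continuous_intros) (metis atLeastAtMost_iff less_irrefl real_sqrt_eq_zero_cancel_iff)
  have F0: "F 0 absolutely_integrable_on ?S"
  proof -
    \<comment> \<open>The endpoint singularities are those of the Beta integral with both parameters
      1/2. The remaining factor \<open>1 / sqrt (h u)\<close> is continuous on the closed interval,
      hence bounded.\<close>
    have "((\<lambda>u. u powr (1/2 - 1) * (1 - u) powr (1/2 - 1)) has_integral Beta (1/2) (1/2)) {0..1::real}"
      by (rule has_integral_Beta_real) auto
    then have "(\<lambda>u. u powr (-1/2) * (1 - u) powr (-1/2)) integrable_on ?S"
      by (auto simp: has_integral_Icc_iff_Ioo integrable_on_def)
    then have "(\<lambda>u::real. u powr (-1/2) * (1 - u) powr (-1/2)) absolutely_integrable_on ?S"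
      by (intro nonnegative_absolutely_integrable_1) auto
    then have "(\<lambda>u. 1 / sqrt (h u) * (u powr (-1/2) * (1 - u) powr (-1/2))) absolutely_integrable_on ?S"
    proof (rule absolutely_integrable_bounded_measurable_product_real[rotated 3])
      show "(\<lambda>u. 1 / sqrt (h u)) \<in> borel_measurable (lebesgue_on ?S)"
        by (intro continuous_imp_measurable_on_sets_lebesgue continuous_on_subset[OF hcont]) auto
      show "bounded ((\<lambda>u. 1 / sqrt (h u)) ` ?S)"
        using compact_imp_bounded[OF compact_continuous_image[OF hcont compact_Icc]]
        by (rule bounded_subset) auto
    qed auto
    then show ?thesis
      by (simp add: F_def[abs_def] mult.commute)
  qed
  have F1_eq: "F 1 u = (1 - u) * F 0 u" if "u \<in> ?S" for u
    using that powr_add[of "1 - u" 1 "-1/2"] by (simp add: F_def)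
  have F1: "F 1 absolutely_integrable_on ?S"
  proof -
    have "(\<lambda>u. (1 - u) * F 0 u) absolutely_integrable_on ?S"
    proof (rule absolutely_integrable_bounded_measurable_product_real[OF _ _ _ F0])
      show "(\<lambda>u. 1 - u) \<in> borel_measurable (lebesgue_on ?S)"
        by (intro continuous_imp_measurable_on_sets_lebesgue continuous_intros) auto
      show "bounded ((\<lambda>u. 1 - u) ` ?S)"
        by (rule boundedI[of _ 1]) auto
    qed auto
    then show ?thesis
      using F1_eq by (subst set_integrable_cong) auto
  qed
  have FD3: "Lauricella_FD3 (1/2) (1/2) (real n + 1) (1/2) (of_real y) (of_real z) =
      of_real (Gamma (real n + 1) / (Gamma (1/2) * Gamma (real n + 1/2)) * J n)"
    if "F n absolutely_integrable_on ?S" for n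
  proof -
    have "F n integrable_on ?S" using that absolutely_integrable_on_def by blast
    then show ?thesis
      using yz Lauricella_FD3_half_eq[of "1/2" y z "real n + 1"]
      by (simp add: J_def F_def[abs_def] h_def algebra_simps)
  qed
  have G: "Lauricella_G (1/2) (of_real y) (of_real z) = of_real (J 0 / pi)"
    using FD3[OF F0] by (simp add: Lauricella_G_def Gamma_one_half_real)
  \<comment> \<open>The Gamma prefactor is 2/pi here and 1/pi for \<open>Lauricella_G\<close>,
    whence the 2 in front of \<open>I 1\<close>.\<close>
  have H: "Lauricella_H1 (1/2) (of_real y) (of_real z) = of_real (2 * (J 1 / pi))"
  proof -
    have "Gamma (3/2 :: real) = sqrt pi / 2"
      using Gamma_plus1[of "1/2 :: real"] nonpos_Ints_nonpos[of "1/2 :: real"]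
      by (auto simp: Gamma_one_half_real)
    then have X: "Gamma (1/2) * Gamma (3/2 :: real) = pi / 2"
      by (simp only: Gamma_one_half_real) simp
    have nums: "real 1 + 1 = 2" "real 1 + 1/2 = 3/2" by simp_all
    have "Gamma (real 1 + 1) / (Gamma (1/2) * Gamma (real 1 + 1/2)) * J 1 = 2 * (J 1 / pi)"
      unfolding nums X by (simp add: Gamma_numeral)
    then show ?thesis
      using FD3[OF F1] by (simp add: Lauricella_H1_def)
  qed
  have period: "has_ell_period (4 * e * sqrt a) (- (a - 1)\<^sup>2) ((sqrt a * J 0 + e * J 1) / C)"
    if e: "e = 1 \<or> e = -1" for e :: real
  proof -
    have e2: "e * e = 1" using e by auto
    have s2: "sqrt a * sqrt a = a" and s1: "1 < sqrt a" using a by auto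
    \<comment> \<open>The sign \<open>e\<close> treats both curves at once. With t = 1 - u this is
      a/t - 2 e sqrt a + t, so its derivative does not depend on \<open>e\<close>, and it is
      positive because t < 1 < a.\<close>
    define g where "g u = (sqrt a - e * (1 - u))\<^sup>2 / (1 - u)" for u
    let ?F = "\<lambda>u. (sqrt a * F 0 u + e * F 1 u) / C"
    have int: "?F absolutely_integrable_on ?S"
      using F0 F1 by (intro set_integral_add set_integrable_divide set_integrable_mult_right) auto
    have "has_ell_period (4 * e * sqrt a) (- (a - 1)\<^sup>2) ((sqrt a * J 0 + e * J 1) / C) \<longleftrightarrow>
        ?F absolutely_integrable_on ?S \<and> integral ?S ?F = (sqrt a * J 0 + e * J 1) / C"
    proof (rule has_ell_period_substitution[where g = g and g' = "\<lambda>u. (a - (1 - u)\<^sup>2) / (1 - u)\<^sup>2" and l = 0])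
      show "(g has_field_derivative (a - (1 - u)\<^sup>2) / (1 - u)\<^sup>2) (at u)" if "u \<in> ?S" for u
      proof -
        define t where "t = 1 - u"
        have u: "u = 1 - t" "t \<noteq> 0" using that by (auto simp: t_def)
        have "(2 * (e * (sqrt a - e * t)) * t + (sqrt a - e * t)\<^sup>2) / (t * t) = (a - t\<^sup>2) / t\<^sup>2"
          using e s2 by (auto simp: power2_eq_square algebra_simps)
        then show ?thesis
          unfolding g_def using u(2)
          by (auto intro!: derivative_eq_intros simp: t_def)
      qed
      show "0 < (a - (1 - u)\<^sup>2) / (1 - u)\<^sup>2" if "u \<in> ?S" for u
      proof -
        have "(1 - u)\<^sup>2 < 1" using that by (simp add: power_less_one_iff)
        then show ?thesis using a that by simp
      qed
      show "(a - (1 - u)\<^sup>2) / (1 - u)\<^sup>2 * ell_integrand (4 * e * sqrt a) (- (a - 1)\<^sup>2) (g u) = ?F u"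
        if "u \<in> ?S" for u
      proof -
        define t where "t = 1 - u"
        have t: "0 < t" "t < 1" and u: "u = 1 - t" using that by (auto simp: t_def)
        define D where "D = sqrt (t * ((1 - t\<^sup>2) * (a\<^sup>2 - t\<^sup>2)))"
        have "t\<^sup>2 < 1" using t by (simp add: power_less_one_iff)
        then have D: "0 < D" using t a2 by (simp add: D_def)
        have "e * t < 1" using e t by auto
        then have se: "0 < sqrt a - e * t" using s1 by linarith
        have "t * ((1 - t\<^sup>2) * (a\<^sup>2 - t\<^sup>2)) = (2 * (a\<^sup>2 - 1)) * (u * (t * h u))"
        proof -
          have "(a + 1) * (1 - y * u) = a + t" "(a - 1) * (1 - z * u) = a - t" "2 * (1 - 1/2 * u) = 1 + t"
            using a by (simp_all add: y_def z_def u field_simps)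
          moreover have "2 * (a\<^sup>2 - 1) * (u * (t * h u)) = u * t *
              ((2 * (1 - 1/2 * u)) * ((a + 1) * (1 - y * u)) * ((a - 1) * (1 - z * u)))"
            unfolding h_def by algebra
          ultimately show ?thesis
            by (simp only:) (simp add: u algebra_simps power2_eq_square)
        qed
        then have DC: "D = C * (sqrt u * (sqrt t * sqrt (h u)))"
          unfolding D_def C_def by (simp only: real_sqrt_mult)
        have F: "F 0 u = C / D"
          using C that hpos[of u] unfolding DC F_def t_def
          by (simp add: powr_minus powr_half_sqrt field_simps)
        have "g u * ((g u)\<^sup>2 + 4 * e * sqrt a * g u + - (a - 1)\<^sup>2) =
            ((sqrt a - e * t) / t\<^sup>2)\<^sup>2 * (t * ((1 - t\<^sup>2) * (a\<^sup>2 - t\<^sup>2)))"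
        proof -
          define s where "s = sqrt a"
          have as: "a = s * s" using a by (simp add: s_def)
          show ?thesis
            using e t unfolding g_def t_def[symmetric] s_def[symmetric] unfolding as
            by (auto simp: field_simps power2_eq_square)
        qed
        then have "sqrt (g u * ((g u)\<^sup>2 + 4 * e * sqrt a * g u + - (a - 1)\<^sup>2)) =
            (sqrt a - e * t) / t\<^sup>2 * D"
          using se t by (simp add: real_sqrt_mult D_def)
        \<comment> \<open>The first factor cancels against the square root just computed; the second
          turns into the combination of \<open>F 0\<close> and \<open>F 1\<close>.\<close>
        moreover have "a - t\<^sup>2 = (sqrt a - e * t) * (sqrt a + e * t)"
          using e s2 by (auto simp: algebra_simps power2_eq_square)
        ultimately have "(a - t\<^sup>2) / t\<^sup>2 * ell_integrand (4 * e * sqrt a) (- (a - 1)\<^sup>2) (g u) =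
            (sqrt a + e * t) / D"
          using se t D by (simp add: ell_integrand_def)
        moreover have "?F u = (sqrt a + e * t) / D"
          unfolding F1_eq[OF that] F using C D by (simp add: t_def field_simps)
        ultimately show ?thesis by (simp add: t_def)
      qed
      show "g 0 = ell_root (4 * e * sqrt a) (- (a - 1)\<^sup>2)"
      proof (rule iffD2[OF ell_root_eq_iff])
        define s where "s = sqrt a"
        have as: "a = s * s" using a by (simp add: s_def)
        show "(g 0)\<^sup>2 + 4 * e * sqrt a * g 0 + - (a - 1)\<^sup>2 = 0"
          using e unfolding g_def s_def[symmetric] unfolding as
          by (auto simp: algebra_simps power2_eq_square)
      qed (use a in \<open>auto simp: g_def\<close>)
      show "continuous_on (insert 0 ?S) g"
        unfolding g_def by (intro continuous_intros) auto
      show "\<exists>u\<in>?S. x < g u" for x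
      proof -
        define d where "d = (sqrt a - 1)\<^sup>2"
        \<comment> \<open>For both signs \<open>sqrt a - e * t\<close> is at least
          \<open>sqrt a - 1\<close>, so \<open>g (1 - t)\<close> is at least \<open>d / t\<close>,
          and this \<open>t\<close> makes that exceed \<open>x\<close>.\<close>
        define t where "t = min (1/2) (d / (\<bar>x\<bar> + 1))"
        have d: "0 < d" using s1 by (simp add: d_def)
        have t: "0 < t" "t < 1" using d by (auto simp: t_def)
        have "t \<le> d / (\<bar>x\<bar> + 1)" by (simp add: t_def)
        then have "\<bar>x\<bar> + 1 \<le> d / t" using t by (simp add: pos_le_divide_eq mult.commute)
        also have "\<dots> \<le> (sqrt a - e * t)\<^sup>2 / t"
          unfolding d_def using e t s1 by (intro divide_right_mono power_mono) auto
        also have "\<dots> = g (1 - t)" by (simp add: g_def)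
        finally show ?thesis
          using t by (intro bexI[of _ "1 - t"]) auto
      qed
    qed auto
    moreover have "integral ?S ?F = (sqrt a * J 0 + e * J 1) / C"
    proof -
      have "F 0 integrable_on ?S" "F 1 integrable_on ?S"
        using F0 F1 absolutely_integrable_on_def by blast+
      then show ?thesis
        unfolding J_def by (simp add: Henstock_Kurzweil_Integration.integral_add integrable_on_mult_right)
    qed
    ultimately show ?thesis using int by simp
  qed
  show thesis
  proof (rule that[of "pi / C" "\<lambda>n. J n / pi"])
    have eq: "(sqrt a * J 0 + e * J 1) / C = pi / C * (sqrt a * (J 0 / pi) + e * (J 1 / pi))" for e
      using C by (simp add: field_simps)
    show "has_ell_period (4 * sqrt a) (- (a - 1)\<^sup>2) (pi / C * (sqrt a * (J 0 / pi) + J 1 / pi))"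
      using period[of 1] unfolding eq by simp
    show "has_ell_period (- 4 * sqrt a) (- (a - 1)\<^sup>2) (pi / C * (sqrt a * (J 0 / pi) - J 1 / pi))"
      using period[of "-1"] unfolding eq by simp
  qed (use C G H in auto)
qed

text \<open>A period ratio \<open>s\<close> means sqrt a I_0 + I_1 = s (sqrt a I_0 - I_1), which
  forces R = 2 sqrt a (s - 1) / (s + 1). The condition on \<open>R\<close> is squared to avoid the
  nested radical sqrt a. For the same reason the curves are rescaled by \<open>sqrt a / l\<close>:
  their coefficients \<open>4 * l\<close>, \<open>- (4 * l)\<close> and \<open>b\<close> then lie in
  the field generated by \<open>a\<close>, and \<open>l\<close> is chosen to clear
  denominators.\<close>

lemma Lauricella_H1_eq_G:
  fixes a b l s R y z :: real
  assumes a: "1 < a" and l: "0 < l" and s: "1 < s"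
    and yz: "y * (1 + a) = 1" "z * (1 - a) = 1"
    and R: "0 \<le> R" "R\<^sup>2 * (s + 1)\<^sup>2 = 4 * a * (s - 1)\<^sup>2"
    and b: "b * a = - (l * (a - 1))\<^sup>2"
    and period: "\<And>I. has_ell_period (- (4 * l)) b I \<Longrightarrow> has_ell_period (4 * l) b (s * I)"
  shows "Lauricella_H1 (1/2) (of_real y) (of_real z) =
    of_real R * Lauricella_G (1/2) (of_real y) (of_real z)"
proof -
  have yz': "y = 1 / (1 + a)" "z = 1 / (1 - a)"
    using a yz by (simp_all add: eq_divide_eq)
  obtain C and I :: "nat \<Rightarrow> real" where C: "0 < C"
    and G: "Lauricella_G (1/2) (of_real y) (of_real z) = of_real (I 0)"
    and H: "Lauricella_H1 (1/2) (of_real y) (of_real z) = of_real (2 * I 1)"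
    and plus: "has_ell_period (4 * sqrt a) (- (a - 1)\<^sup>2) (C * (sqrt a * I 0 + I 1))"
    and minus: "has_ell_period (- 4 * sqrt a) (- (a - 1)\<^sup>2) (C * (sqrt a * I 0 - I 1))"
    using ell_periods_of_Lauricella[OF a] unfolding yz' by blast
  define k where "k = sqrt a / l"
  have k: "0 < k" using a l by (simp add: k_def)
  have b': "b = - (l * (a - 1))\<^sup>2 / a" using a b by (intro eq_divide_imp) auto
  then have neg: "b < 0" using a l by simp
  have coeffs: "4 * sqrt a = k * (4 * l)" "- 4 * sqrt a = k * (- (4 * l))"
    "- (a - 1)\<^sup>2 = k\<^sup>2 * b"
    using a l by (simp_all add: k_def b' power_divide power_mult_distrib)
  have "has_ell_period (4 * l) b (sqrt k * (C * (sqrt a * I 0 + I 1)))"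
    using plus unfolding coeffs has_ell_period_scale[OF k neg] .
  moreover have "has_ell_period (4 * l) b (s * (sqrt k * (C * (sqrt a * I 0 - I 1))))"
    using minus unfolding coeffs has_ell_period_scale[OF k neg] by (rule period)
  ultimately have "sqrt k * (C * (sqrt a * I 0 + I 1)) = s * (sqrt k * (C * (sqrt a * I 0 - I 1)))"
    by (rule has_ell_period_unique)
  then have "(sqrt k * C) * (sqrt a * I 0 + I 1) = (sqrt k * C) * (s * (sqrt a * I 0 - I 1))"
    by (simp only: ac_simps)
  then have "sqrt a * I 0 + I 1 = s * (sqrt a * I 0 - I 1)"
    using C k by simp
  then have I: "(s + 1) * I 1 = (s - 1) * sqrt a * I 0"
    by (simp add: algebra_simps)
  have "(R * (s + 1))\<^sup>2 = (2 * sqrt a * (s - 1))\<^sup>2"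
    using a R(2) by (simp add: power_mult_distrib)
  then have "R * (s + 1) = 2 * sqrt a * (s - 1)"
    using a s R(1) by (subst (asm) power2_eq_iff_nonneg) auto
  then have "R * (s + 1) * I 0 = 2 * sqrt a * (s - 1) * I 0"
    by simp
  then have "(s + 1) * (R * I 0) = 2 * ((s - 1) * sqrt a * I 0)"
    by (simp only: ac_simps)
  then have "(s + 1) * (2 * I 1) = (s + 1) * (R * I 0)"
    unfolding I[symmetric] by (simp only: ac_simps)
  then have "2 * I 1 = R * I 0"
    using s by auto
  then show ?thesis
    unfolding G H by (metis of_real_mult)
qed

section \<open>Arithmetic in quadratic and biquadratic fields\<close>

text \<open>Elements of real number fields are kept in coordinates, so that the simplifier verifies the
  polynomial identities of the isogenies by arithmetic on the coordinates.\<close>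

definition quad :: "real \<Rightarrow> real \<Rightarrow> real \<Rightarrow> real" where
  "quad d p q = p + q * sqrt d"

lemma quad_add: "quad d p q + quad d p' q' = quad d (p + p') (q + q')"
  and quad_diff: "quad d p q - quad d p' q' = quad d (p - p') (q - q')"
  and quad_uminus: "- quad d p q = quad d (- p) (- q)"
  and quad_numeral_mult: "numeral k * quad d p q = quad d (numeral k * p) (numeral k * q)"
    "quad d p q * numeral k = quad d (p * numeral k) (q * numeral k)"
  and quad_mult: "0 \<le> d \<Longrightarrow>
    quad d p q * quad d p' q' = quad d (p * p' + d * (q * q')) (p * q' + q * p')"
  by (simp_all add: quad_def algebra_simps)

lemma quad_one_add: "1 + quad d p q = quad d (1 + p) q" "quad d p q + 1 = quad d (p + 1) q"
  and quad_numeral_add: "numeral k + quad d p q = quad d (numeral k + p) q"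
    "quad d p q + numeral k = quad d (p + numeral k) q"
  by (simp_all add: quad_def)

text \<open>Comparing the squares of the two summands decides the sign by rational
  arithmetic.\<close>

lemma quad_pos:
  assumes "0 \<le> d" "0 < p \<and> q\<^sup>2 * d < p\<^sup>2 \<or> 0 < q \<and> p\<^sup>2 < q\<^sup>2 * d"
  shows "0 < quad d p q"
proof -
  have "sqrt (q\<^sup>2 * d) = \<bar>q\<bar> * sqrt d"
    by (simp add: real_sqrt_mult)
  then have root: "\<bar>q * sqrt d\<bar> = sqrt (q\<^sup>2 * d)"
    using assms(1) by (simp add: abs_mult)
  from assms(2) show ?thesis
  proof (elim disjE conjE)
    assume "0 < p" "q\<^sup>2 * d < p\<^sup>2"
    then have "\<bar>q * sqrt d\<bar> < p"
      using real_sqrt_less_mono[of "q\<^sup>2 * d" "p\<^sup>2"] root by simp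
    then show ?thesis unfolding quad_def by linarith
  next
    assume "0 < q" "p\<^sup>2 < q\<^sup>2 * d"
    then have "\<bar>p\<bar> < \<bar>q * sqrt d\<bar>"
      using real_sqrt_less_mono[of "p\<^sup>2" "q\<^sup>2 * d"] root by simp
    moreover have "0 \<le> q * sqrt d" using \<open>0 < q\<close> assms(1) by simp
    ultimately show ?thesis unfolding quad_def by linarith
  qed
qed

lemma quad_neg: "0 \<le> d \<Longrightarrow> p < 0 \<and> q\<^sup>2 * d < p\<^sup>2 \<or> q < 0 \<and> p\<^sup>2 < q\<^sup>2 * d \<Longrightarrow> quad d p q < 0"
  using quad_pos[of d "- p" "- q"] by (simp flip: quad_uminus)

definition biquad :: "real \<Rightarrow> real \<Rightarrow> real \<Rightarrow> real \<Rightarrow> real \<Rightarrow> real \<Rightarrow> real" where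
  "biquad d e p q r s = p + q * sqrt d + r * sqrt e + s * (sqrt d * sqrt e)"

lemma biquad_add: "biquad d e p q r s + biquad d e p' q' r' s' =
    biquad d e (p + p') (q + q') (r + r') (s + s')"
  and biquad_diff: "biquad d e p q r s - biquad d e p' q' r' s' =
    biquad d e (p - p') (q - q') (r - r') (s - s')"
  and biquad_uminus: "- biquad d e p q r s = biquad d e (- p) (- q) (- r) (- s)"
  and biquad_numeral_mult:
    "numeral k * biquad d e p q r s =
      biquad d e (numeral k * p) (numeral k * q) (numeral k * r) (numeral k * s)"
    "biquad d e p q r s * numeral k =
      biquad d e (p * numeral k) (q * numeral k) (r * numeral k) (s * numeral k)"
  by (simp_all add: biquad_def algebra_simps)

lemma biquad_one_add: "1 + biquad d e p q r s = biquad d e (1 + p) q r s"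
    "biquad d e p q r s + 1 = biquad d e (p + 1) q r s"
  and biquad_numeral_add: "numeral k + biquad d e p q r s = biquad d e (numeral k + p) q r s"
    "biquad d e p q r s + numeral k = biquad d e (p + numeral k) q r s"
  by (simp_all add: biquad_def)

lemma biquad_mult:
  assumes "0 \<le> d" "0 \<le> e"
  shows "biquad d e p q r s * biquad d e p' q' r' s' =
    biquad d e (p * p' + d * (q * q') + e * (r * r' + d * (s * s')))
      (p * q' + q * p' + e * (r * s' + s * r'))
      (p * r' + r * p' + d * (q * s' + s * q')) (p * s' + s * p' + q * r' + r * q')"
proof -
  obtain u where u: "sqrt d = u" "d = u * u"
    using assms by (metis real_sqrt_mult_self abs_of_nonneg)
  obtain v where v: "sqrt e = v" "e = v * v"
    using assms by (metis real_sqrt_mult_self abs_of_nonneg)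
  show ?thesis
    unfolding biquad_def u(1) v(1) unfolding u(2) v(2) by algebra
qed

text \<open>The number is \<open>quad e\<close> applied to two elements of the field of
  \<open>sqrt d\<close>, so the criterion \<open>quad_pos\<close> is used on two levels. The second
  inequality of each pair is the comparison of squares, written out in coordinates.\<close>

lemma biquad_pos:
  assumes "0 \<le> d" "0 \<le> e"
    and "0 < quad d p q \<and>
        0 < quad d (p * p + d * (q * q) - e * (r * r + d * (s * s))) (2 * (p * q - e * (r * s))) \<or>
      0 < quad d r s \<and>
        0 < quad d (e * (r * r + d * (s * s)) - p * p - d * (q * q)) (2 * (e * (r * s) - p * q))"
  shows "0 < biquad d e p q r s"
proof -
  have "biquad d e p q r s = quad e (quad d p q) (quad d r s)"
    by (simp add: biquad_def quad_def algebra_simps)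
  moreover have diff: "(quad d p q)\<^sup>2 - (quad d r s)\<^sup>2 * e =
      quad d (p * p + d * (q * q) - e * (r * r + d * (s * s))) (2 * (p * q - e * (r * s)))"
    "(quad d r s)\<^sup>2 * e - (quad d p q)\<^sup>2 =
      quad d (e * (r * r + d * (s * s)) - p * p - d * (q * q)) (2 * (e * (r * s) - p * q))"
    using assms(1)
    by (simp_all only: power2_eq_square quad_mult) (simp_all add: quad_def algebra_simps)
  ultimately show ?thesis
    using assms(3) quad_pos[OF assms(2), of "quad d p q" "quad d r s"]
    unfolding diff[symmetric] diff_gt_0_iff_gt by simp
qed

lemma biquad_neg: "0 < biquad d e (- p) (- q) (- r) (- s) \<Longrightarrow> biquad d e p q r s < 0"
  by (simp flip: biquad_uminus)

lemmas quad_simps = quad_add quad_diff quad_uminus quad_numeral_mult quad_mult quad_one_add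
  quad_numeral_add biquad_add biquad_diff biquad_uminus biquad_numeral_mult biquad_mult
  biquad_one_add biquad_numeral_add

text \<open>The last two rules give nonzero leading coefficients, from which degrees are
  computed.\<close>

lemmas quad_signs = quad_pos quad_neg biquad_pos biquad_neg
  quad_pos[THEN less_imp_neq, symmetric] biquad_pos[THEN less_imp_neq, symmetric]

section \<open>The explicit isogenies\<close>

text \<open>The polynomials were found by expanding the Weierstrass functions of both curves at the
  origin, solving for the rational function that relates them, and scaling \<open>x\<close> so as to make
  all coordinates integral.\<close>

lemma isogeny_3:
  assumes "has_ell_period (- 12) (- 12) I"
  shows "has_ell_period 36 (- 108) (1 * I)"
proof (rule has_ell_period_isogeny[OF _ _ _ _ _ _ _ _ _ _ _ _ _ assms])
  define P :: "real poly" where "P = [:- 6, 1:]"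
  define Q :: "real poly" where "Q = [:2, 1:]"
  define W :: "real poly" where "W = [:- 12, 12, 1:]"
  show "smult 1 W = P * Q + [:0, 2:] * (pderiv P * Q - P * pderiv Q)"
    by (simp add: P_def Q_def W_def pderiv_pCons quad_simps)
  show "[:0, 1:] * P\<^sup>2 * ([:0, 1:] * P\<^sup>2 + smult 36 (Q\<^sup>2)) + smult (- 108) ((Q\<^sup>2)\<^sup>2)
      = [:- 12, - 12, 1:] * W\<^sup>2"
    by (simp add: P_def Q_def W_def power2_eq_square quad_simps)
  \<comment> \<open>The shift is minus the linear coefficient of the source curve: there the
    quadratic takes the value of its constant term, which is negative. The same choice is made for
    every isogeny below whose source has a negative linear coefficient.\<close>
  show "pos_coeffs (pcompose P [:12, 1:])" "pos_coeffs Q" "pos_coeffs (pcompose W [:12, 1:])"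
    by (simp_all add: P_def Q_def W_def pcompose_pCons pos_coeffs.intros quad_simps quad_signs)
  show "degree P = degree Q" "0 < lead_coeff P" "0 < lead_coeff Q"
    by (simp_all add: P_def Q_def quad_signs)
qed (simp_all add: quad_simps quad_signs)

lemma isogeny_5:
  assumes "has_ell_period (quad 5 (- 4) 0) (quad 5 2 (- 1)) I"
  shows "has_ell_period (quad 5 4 0) (quad 5 2 (- 1)) (quad 5 0 1 * I)"
proof (rule has_ell_period_isogeny[OF _ _ _ _ _ _ _ _ _ _ _ _ _ assms])
  define P :: "real poly" where "P = [:quad 5 5 (- 2), quad 5 (- 5) 1, quad 5 1 0:]"
  define Q :: "real poly" where "Q = [:quad 5 (- 2) 1, quad 5 5 (- 1), quad 5 0 1:]"
  define W :: "real poly" where "W = [:quad 5 9 (- 4), quad 5 (- 6) 2, quad 5 0 (- 2), quad 5 2 2, quad 5 1 0:]"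
  \<comment> \<open>The multiplier is the leading coefficient of \<open>Q\<close> over that of
    \<open>P\<close>, because the isogeny behaves like x / k^2 at infinity.\<close>
  show "smult (quad 5 0 1) W = P * Q + [:0, 2:] * (pderiv P * Q - P * pderiv Q)"
    by (simp add: P_def Q_def W_def pderiv_pCons quad_simps)
  show "[:0, 1:] * P\<^sup>2 * ([:0, 1:] * P\<^sup>2 + smult (quad 5 4 0) (Q\<^sup>2)) + smult (quad 5 2 (- 1)) ((Q\<^sup>2)\<^sup>2)
      = [:quad 5 2 (- 1), quad 5 (- 4) 0, 1:] * W\<^sup>2"
    by (simp add: P_def Q_def W_def power2_eq_square quad_simps)
  show "pos_coeffs (pcompose P [:4, 1:])" "pos_coeffs Q" "pos_coeffs (pcompose W [:4, 1:])"
    by (simp_all add: P_def Q_def W_def pcompose_pCons pos_coeffs.intros quad_simps quad_signs)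
  show "degree P = degree Q" "0 < lead_coeff P" "0 < lead_coeff Q"
    by (simp_all add: P_def Q_def quad_signs)
qed (simp_all add: quad_simps quad_signs)

lemma isogeny_7:
  assumes "has_ell_period (- 84) (- 28) I"
  shows "has_ell_period 588 (- 1372) (1 * I)"
proof (rule has_ell_period_isogeny[OF _ _ _ _ _ _ _ _ _ _ _ _ _ assms])
  define P :: "real poly" where "P = [:- 392, 588, - 70, 1:]"
  define Q :: "real poly" where "Q = [:56, 140, 42, 1:]"
  define W :: "real poly" where "W = [:- 21952, 153664, 112112, - 51744, - 4004, 196, 1:]"
  show "smult 1 W = P * Q + [:0, 2:] * (pderiv P * Q - P * pderiv Q)"
    by (simp add: P_def Q_def W_def pderiv_pCons quad_simps)
  show "[:0, 1:] * P\<^sup>2 * ([:0, 1:] * P\<^sup>2 + smult 588 (Q\<^sup>2)) + smult (- 1372) ((Q\<^sup>2)\<^sup>2)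
      = [:- 28, - 84, 1:] * W\<^sup>2"
    by (simp add: P_def Q_def W_def power2_eq_square quad_simps)
  show "pos_coeffs (pcompose P [:84, 1:])" "pos_coeffs Q" "pos_coeffs (pcompose W [:84, 1:])"
    by (simp_all add: P_def Q_def W_def pcompose_pCons pos_coeffs.intros quad_simps quad_signs)
  show "degree P = degree Q" "0 < lead_coeff P" "0 < lead_coeff Q"
    by (simp_all add: P_def Q_def quad_signs)
qed (simp_all add: quad_simps quad_signs)

text \<open>The intermediate curve has linear coefficient 0. It has complex multiplication by i and
  is its own twist by -1, a natural halfway point since sqrt (-9) = 3i. The same happens for order
  25.\<close>

lemma isogeny_9_first:
  assumes "has_ell_period (quad 3 (- 24) 0) (quad 3 72 (- 42)) I"
  shows "has_ell_period (quad 3 0 0) (quad 3 0 (- 18)) (quad 3 0 1 * I)"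
proof (rule has_ell_period_isogeny[OF _ _ _ _ _ _ _ _ _ _ _ _ _ assms])
  define P :: "real poly" where "P = [:quad 3 (- 9) 3, quad 3 1 0:]"
  define Q :: "real poly" where "Q = [:quad 3 9 (- 5), quad 3 0 1:]"
  define W :: "real poly" where "W = [:quad 3 72 (- 42), quad 3 (- 6) 6, quad 3 1 0:]"
  show "smult (quad 3 0 1) W = P * Q + [:0, 2:] * (pderiv P * Q - P * pderiv Q)"
    by (simp add: P_def Q_def W_def pderiv_pCons quad_simps)
  show "[:0, 1:] * P\<^sup>2 * ([:0, 1:] * P\<^sup>2 + smult (quad 3 0 0) (Q\<^sup>2)) + smult (quad 3 0 (- 18)) ((Q\<^sup>2)\<^sup>2)
      = [:quad 3 72 (- 42), quad 3 (- 24) 0, 1:] * W\<^sup>2"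
    by (simp add: P_def Q_def W_def power2_eq_square quad_simps)
  show "pos_coeffs (pcompose P [:24, 1:])" "pos_coeffs Q" "pos_coeffs (pcompose W [:24, 1:])"
    by (simp_all add: P_def Q_def W_def pcompose_pCons pos_coeffs.intros quad_simps quad_signs)
  show "degree P = degree Q" "0 < lead_coeff P" "0 < lead_coeff Q"
    by (simp_all add: P_def Q_def quad_signs)
qed (simp_all add: quad_simps quad_signs)

lemma isogeny_9_second:
  assumes "has_ell_period (quad 3 0 0) (quad 3 0 (- 18)) I"
  shows "has_ell_period (quad 3 24 0) (quad 3 72 (- 42)) (quad 3 0 1 * I)"
proof (rule has_ell_period_isogeny[OF _ _ _ _ _ _ _ _ _ _ _ _ _ assms])
  define P :: "real poly" where "P = [:quad 3 (- 9) 3, quad 3 1 0:]"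
  define Q :: "real poly" where "Q = [:quad 3 9 3, quad 3 0 1:]"
  define W :: "real poly" where "W = [:quad 3 0 (- 18), quad 3 18 6, quad 3 1 0:]"
  show "smult (quad 3 0 1) W = P * Q + [:0, 2:] * (pderiv P * Q - P * pderiv Q)"
    by (simp add: P_def Q_def W_def pderiv_pCons quad_simps)
  show "[:0, 1:] * P\<^sup>2 * ([:0, 1:] * P\<^sup>2 + smult (quad 3 24 0) (Q\<^sup>2)) + smult (quad 3 72 (- 42)) ((Q\<^sup>2)\<^sup>2)
      = [:quad 3 0 (- 18), quad 3 0 0, 1:] * W\<^sup>2"
    by (simp add: P_def Q_def W_def power2_eq_square quad_simps)
  show "pos_coeffs (pcompose P [:4, 1:])" "pos_coeffs Q" "pos_coeffs (pcompose W [:4, 1:])"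
    by (simp_all add: P_def Q_def W_def pcompose_pCons pos_coeffs.intros quad_simps quad_signs)
  show "degree P = degree Q" "0 < lead_coeff P" "0 < lead_coeff Q"
    by (simp_all add: P_def Q_def quad_signs)
qed (simp_all add: quad_simps quad_signs)

lemma isogeny_13:
  assumes "has_ell_period (quad 13 (- 12) 0) (quad 13 18 (- 5)) I"
  shows "has_ell_period (quad 13 12 0) (quad 13 18 (- 5)) (quad 13 0 1 * I)"
proof (rule has_ell_period_isogeny[OF _ _ _ _ _ _ _ _ _ _ _ _ _ assms])
  define P :: "real poly" where "P = [:quad 13 84305 (- 23382), quad 13 (- 84799) 23519, quad 13 33397 (- 9262), quad 13 (-
      6578) 1818, quad 13 689 (- 180), quad 13 (- 39) 7, quad 13 1 0:]"
  define Q :: "real poly" where "Q = [:quad 13 (- 23382) 6485, quad 13 41691 (- 11563), quad 13 (- 24102) 6685, quad 13 6578 (-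
      1818), quad 13 (- 884) 269, quad 13 91 (- 11), quad 13 0 1:]"
  define W :: "real poly" where "W = [:quad 13 1093435849 (- 303264540), quad 13 (- 1349890642) 374392302, quad 13 745383944 (-
      206732310), quad 13 (- 243999618) 67673318, quad 13 53810431 (- 14924328), quad 13 (-
      9109716) 2526572, quad 13 1456000 (- 403892), quad 13 (- 252292) 70284, quad 13 42199 (-
      11292), quad 13 (- 5914) 1254, quad 13 344 (- 150), quad 13 6 14, quad 13 1 0:]"
  show "smult (quad 13 0 1) W = P * Q + [:0, 2:] * (pderiv P * Q - P * pderiv Q)"
    by (simp add: P_def Q_def W_def pderiv_pCons quad_simps)
  show "[:0, 1:] * P\<^sup>2 * ([:0, 1:] * P\<^sup>2 + smult (quad 13 12 0) (Q\<^sup>2)) + smult (quad 13 18 (- 5)) ((Q\<^sup>2)\<^sup>2)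
      = [:quad 13 18 (- 5), quad 13 (- 12) 0, 1:] * W\<^sup>2"
    by (simp add: P_def Q_def W_def power2_eq_square quad_simps)
  show "pos_coeffs (pcompose P [:12, 1:])" "pos_coeffs Q" "pos_coeffs (pcompose W [:12, 1:])"
    by (simp_all add: P_def Q_def W_def pcompose_pCons pos_coeffs.intros quad_simps quad_signs)
  show "degree P = degree Q" "0 < lead_coeff P" "0 < lead_coeff Q"
    by (simp_all add: P_def Q_def quad_signs)
qed (simp_all add: quad_simps quad_signs)

text \<open>This factor has degree 5 and the next one degree 3. As sqrt 3 is not in the field of
  sqrt 5, the second isogeny has multiplier 1 and a rescaled target.\<close>

lemma isogeny_15_first:
  assumes "has_ell_period (quad 5 (- 132) 0) (quad 5 (- 6012) 2688) I"
  shows "has_ell_period (quad 5 348 (- 144)) (quad 5 (- 252) (- 96)) (quad 5 0 1 * I)"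
proof (rule has_ell_period_isogeny[OF _ _ _ _ _ _ _ _ _ _ _ _ _ assms])
  define P :: "real poly" where "P = [:quad 5 3180 (- 1416), quad 5 (- 120) 36, quad 5 1 0:]"
  define Q :: "real poly" where "Q = [:quad 5 (- 25464) 11388, quad 5 (- 420) 192, quad 5 0 1:]"
  define W :: "real poly" where "W = [:quad 5 72270864 (- 32320512), quad 5 (- 8055072) 3602304, quad 5 9240 (- 4224), quad 5
      696 (- 288), quad 5 1 0:]"
  show "smult (quad 5 0 1) W = P * Q + [:0, 2:] * (pderiv P * Q - P * pderiv Q)"
    by (simp add: P_def Q_def W_def pderiv_pCons quad_simps)
  show "[:0, 1:] * P\<^sup>2 * ([:0, 1:] * P\<^sup>2 + smult (quad 5 348 (- 144)) (Q\<^sup>2)) + smult (quad 5 (- 252) (- 96)) ((Q\<^sup>2)\<^sup>2)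
      = [:quad 5 (- 6012) 2688, quad 5 (- 132) 0, 1:] * W\<^sup>2"
    by (simp add: P_def Q_def W_def power2_eq_square quad_simps)
  show "pos_coeffs (pcompose P [:132, 1:])" "pos_coeffs Q" "pos_coeffs (pcompose W [:132, 1:])"
    by (simp_all add: P_def Q_def W_def pcompose_pCons pos_coeffs.intros quad_simps quad_signs)
  show "degree P = degree Q" "0 < lead_coeff P" "0 < lead_coeff Q"
    by (simp_all add: P_def Q_def quad_signs)
qed (simp_all add: quad_simps quad_signs)

lemma isogeny_15_second:
  assumes "has_ell_period (quad 5 1740 (- 720)) (quad 5 (- 6300) (- 2400)) I"
  shows "has_ell_period (quad 5 1980 0) (quad 5 (- 1352700) 604800) (quad 5 1 0 * I)"
proof (rule has_ell_period_isogeny[OF _ _ _ _ _ _ _ _ _ _ _ _ _ assms])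
  define P :: "real poly" where "P = [:quad 5 90 (- 60), quad 5 1 0:]"
  define Q :: "real poly" where "Q = [:quad 5 130 60, quad 5 1 0:]"
  define W :: "real poly" where "W = [:quad 5 (- 6300) (- 2400), quad 5 300 240, quad 5 1 0:]"
  show "smult (quad 5 1 0) W = P * Q + [:0, 2:] * (pderiv P * Q - P * pderiv Q)"
    by (simp add: P_def Q_def W_def pderiv_pCons quad_simps)
  show "[:0, 1:] * P\<^sup>2 * ([:0, 1:] * P\<^sup>2 + smult (quad 5 1980 0) (Q\<^sup>2)) + smult (quad 5 (- 1352700) 604800) ((Q\<^sup>2)\<^sup>2)
      = [:quad 5 (- 6300) (- 2400), quad 5 1740 (- 720), 1:] * W\<^sup>2"
    by (simp add: P_def Q_def W_def power2_eq_square quad_simps)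
  show "pos_coeffs (pcompose P [:50, 1:])" "pos_coeffs Q" "pos_coeffs (pcompose W [:50, 1:])"
    by (simp_all add: P_def Q_def W_def pcompose_pCons pos_coeffs.intros quad_simps quad_signs)
  show "degree P = degree Q" "0 < lead_coeff P" "0 < lead_coeff Q"
    by (simp_all add: P_def Q_def quad_signs)
qed (simp_all add: quad_simps quad_signs)

lemma isogeny_25_first:
  assumes "has_ell_period (quad 5 (- 120) 0) (quad 5 1800 (- 805)) I"
  shows "has_ell_period (quad 5 0 0) (quad 5 0 (- 125)) (quad 5 0 1 * I)"
proof (rule has_ell_period_isogeny[OF _ _ _ _ _ _ _ _ _ _ _ _ _ assms])
  define P :: "real poly" where "P = [:quad 5 2125 (- 950), quad 5 (- 75) 25, quad 5 1 0:]"
  define Q :: "real poly" where "Q = [:quad 5 (- 3410) 1525, quad 5 125 (- 55), quad 5 0 1:]"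
  define W :: "real poly" where "W = [:quad 5 6480125 (- 2898000), quad 5 (- 363250) 162450, quad 5 8500 (- 3810), quad 5 (-
      90) 50, quad 5 1 0:]"
  show "smult (quad 5 0 1) W = P * Q + [:0, 2:] * (pderiv P * Q - P * pderiv Q)"
    by (simp add: P_def Q_def W_def pderiv_pCons quad_simps)
  show "[:0, 1:] * P\<^sup>2 * ([:0, 1:] * P\<^sup>2 + smult (quad 5 0 0) (Q\<^sup>2)) + smult (quad 5 0 (- 125)) ((Q\<^sup>2)\<^sup>2)
      = [:quad 5 1800 (- 805), quad 5 (- 120) 0, 1:] * W\<^sup>2"
    by (simp add: P_def Q_def W_def power2_eq_square quad_simps)
  show "pos_coeffs (pcompose P [:120, 1:])" "pos_coeffs Q" "pos_coeffs (pcompose W [:120, 1:])"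
    by (simp_all add: P_def Q_def W_def pcompose_pCons pos_coeffs.intros quad_simps quad_signs)
  show "degree P = degree Q" "0 < lead_coeff P" "0 < lead_coeff Q"
    by (simp_all add: P_def Q_def quad_signs)
qed (simp_all add: quad_simps quad_signs)

lemma isogeny_25_second:
  assumes "has_ell_period (quad 5 0 0) (quad 5 0 (- 125)) I"
  shows "has_ell_period (quad 5 120 0) (quad 5 1800 (- 805)) (quad 5 0 1 * I)"
proof (rule has_ell_period_isogeny[OF _ _ _ _ _ _ _ _ _ _ _ _ _ assms])
  define P :: "real poly" where "P = [:quad 5 625 (- 250), quad 5 (- 75) 25, quad 5 1 0:]"
  define Q :: "real poly" where "Q = [:quad 5 1250 625, quad 5 125 25, quad 5 0 1:]"
  define W :: "real poly" where "W = [:quad 5 78125 0, quad 5 (- 31250) (- 18750), quad 5 2500 750, quad 5 150 50, quad 5 1 0:]"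
  show "smult (quad 5 0 1) W = P * Q + [:0, 2:] * (pderiv P * Q - P * pderiv Q)"
    by (simp add: P_def Q_def W_def pderiv_pCons quad_simps)
  show "[:0, 1:] * P\<^sup>2 * ([:0, 1:] * P\<^sup>2 + smult (quad 5 120 0) (Q\<^sup>2)) + smult (quad 5 1800 (- 805)) ((Q\<^sup>2)\<^sup>2)
      = [:quad 5 0 (- 125), quad 5 0 0, 1:] * W\<^sup>2"
    by (simp add: P_def Q_def W_def power2_eq_square quad_simps)
  show "pos_coeffs (pcompose P [:15, 1:])" "pos_coeffs Q" "pos_coeffs (pcompose W [:15, 1:])"
    by (simp_all add: P_def Q_def W_def pcompose_pCons pos_coeffs.intros quad_simps quad_signs)
  show "degree P = degree Q" "0 < lead_coeff P" "0 < lead_coeff Q"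
    by (simp_all add: P_def Q_def quad_signs)
qed (simp_all add: quad_simps quad_signs)

text \<open>This factor has degree 11 and multiplier sqrt 11; the next one has degree 3 and
  multiplier sqrt 3.\<close>

lemma isogeny_33_first:
  assumes "has_ell_period (biquad 3 11 (- 48) 0 0 0) (biquad 3 11 288 (- 195) 15 0) I"
  shows "has_ell_period (biquad 3 11 84 0 0 (- 12))
      (biquad 3 11 1476 (- 855) 435 (- 252)) (biquad 3 11 0 0 1 0 * I)"
proof (rule has_ell_period_isogeny[OF _ _ _ _ _ _ _ _ _ _ _ _ _ assms])
  define P :: "real poly" where "P = [:biquad 3 11 (- 41445756) 23912460 (- 7845660) 4534596, biquad 3 11 10312236 (- 5920992)
      2203488 (- 1282068), biquad 3 11 (- 814572) 457908 (- 172260) 103188, biquad 3 11 26400 (-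
      13860) 4788 (- 3168), biquad 3 11 (- 363) 143 (- 39) 33, biquad 3 11 2 0 0 0:]"
  define Q :: "real poly" where "Q = [:biquad 3 11 2797740 (- 2278404) (- 2928204) 1890540, biquad 3 11 142560 (- 667260)
      1391436 (- 626976), biquad 3 11 (- 288684) 8844 (- 105948) 108756, biquad 3 11 (- 4884) (-
      11616) 10848 (- 1908), biquad 3 11 (- 429) (- 121) (- 39) 143, biquad 3 11 0 0 2 0:]"
  define W :: "real poly" where "W = [:biquad 3 11 204038973084672 (- 117813216830400) 23292090820800 (- 13444299648000),
      biquad 3 11 (- 33707389387968) 19539015815232 2069766177984 (- 1218511657152), biquad 3 11
      3607054833312 (- 2097353668608) (- 689970161664) 402822732960, biquad 3 11 (-
      298119533184) 151838444160 79139514240 (- 39576283776), biquad 3 11 16976577024 (-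
      9440553888) (- 4905284832) 2723258880, biquad 3 11 (- 271234656) 738356256 77809248 (-
      220330080), biquad 3 11 25699248 (- 18464256) (- 7432704) 5384880, biquad 3 11 (- 2605536)
      (- 544800) 761760 177696, biquad 3 11 30336 (- 2844) (- 8052) 0, biquad 3 11 492 572 (-
      156) (- 132), biquad 3 11 4 0 0 0:]"
  show "smult (biquad 3 11 0 0 1 0) W = P * Q + [:0, 2:] * (pderiv P * Q - P * pderiv Q)"
    by (simp add: P_def Q_def W_def pderiv_pCons quad_simps)
  show "[:0, 1:] * P\<^sup>2 * ([:0, 1:] * P\<^sup>2 + smult (biquad 3 11 84 0 0 (- 12)) (Q\<^sup>2)) + smult (biquad 3 11 1476 (- 855) 435 (- 252)) ((Q\<^sup>2)\<^sup>2)
      = [:biquad 3 11 288 (- 195) 15 0, biquad 3 11 (- 48) 0 0 0, 1:] * W\<^sup>2"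
    by (simp add: P_def Q_def W_def power2_eq_square quad_simps)
  show "pos_coeffs (pcompose P [:48, 1:])" "pos_coeffs Q" "pos_coeffs (pcompose W [:48, 1:])"
    by (simp_all add: P_def Q_def W_def pcompose_pCons pos_coeffs.intros quad_simps quad_signs)
  show "degree P = degree Q" "0 < lead_coeff P" "0 < lead_coeff Q"
    by (simp_all add: P_def Q_def quad_signs)
qed (simp_all add: quad_simps quad_signs)

lemma isogeny_33_second:
  assumes "has_ell_period (biquad 3 11 924 0 0 (- 132))
      (biquad 3 11 178596 (- 103455) 52635 (- 30492)) I"
  shows "has_ell_period (biquad 3 11 528 0 0 0)
      (biquad 3 11 34848 (- 23595) 1815 0) (biquad 3 11 0 1 0 0 * I)"
proof (rule has_ell_period_isogeny[OF _ _ _ _ _ _ _ _ _ _ _ _ _ assms])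
  define P :: "real poly" where "P = [:biquad 3 11 297 (- 165) 165 (- 99), biquad 3 11 2 0 0 0:]"
  define Q :: "real poly" where "Q = [:biquad 3 11 (- 495) 517 (- 165) 165, biquad 3 11 0 2 0 0:]"
  define W :: "real poly" where "W = [:biquad 3 11 714384 (- 413820) 210540 (- 121968), biquad 3 11 2508 (- 660) 660 (- 132),
      biquad 3 11 4 0 0 0:]"
  show "smult (biquad 3 11 0 1 0 0) W = P * Q + [:0, 2:] * (pderiv P * Q - P * pderiv Q)"
    by (simp add: P_def Q_def W_def pderiv_pCons quad_simps)
  show "[:0, 1:] * P\<^sup>2 * ([:0, 1:] * P\<^sup>2 + smult (biquad 3 11 528 0 0 0) (Q\<^sup>2)) + smult (biquad 3 11 34848 (- 23595) 1815 0) ((Q\<^sup>2)\<^sup>2)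
      = [:biquad 3 11 178596 (- 103455) 52635 (- 30492), biquad 3 11 924 0 0 (- 132), 1:] * W\<^sup>2"
    by (simp add: P_def Q_def W_def power2_eq_square quad_simps)
  show "pos_coeffs (pcompose P [:6, 1:])" "pos_coeffs Q" "pos_coeffs (pcompose W [:6, 1:])"
    by (simp_all add: P_def Q_def W_def pcompose_pCons pos_coeffs.intros quad_simps quad_signs)
  show "degree P = degree Q" "0 < lead_coeff P" "0 < lead_coeff Q"
    by (simp_all add: P_def Q_def quad_signs)
qed (simp_all add: quad_simps quad_signs)

section \<open>The singular values\<close>

lemma quad_rational: "quad d p 0 = p"
  and quad_sqrt: "quad d 0 1 = sqrt d"
  by (simp_all add: quad_def)

text \<open>Normalised products are nested to the right, so a repeated square root also shows up in
  this shape.\<close>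

lemma sqrt_mult_sqrt_mult: "0 \<le> x \<Longrightarrow> sqrt x * (sqrt x * y) = x * y"
  by (simp flip: mult.assoc)

lemmas sqrt_ring_simps = algebra_simps power2_eq_square add_divide_distrib diff_divide_distrib
  sqrt_mult_sqrt_mult

lemma root_4_eq: "root 4 x = sqrt (sqrt x)"
  using real_root_mult_exp[of 2 2 x] by (simp add: sqrt_def)

lemma biquad_rational: "biquad d e p 0 0 0 = p"
  and biquad_sqrt: "biquad d e 0 1 0 0 = sqrt d" "biquad d e 0 0 1 0 = sqrt e"
  by (simp_all add: biquad_def)

lemma Lauricella_order_3:
  fixes y z R :: real
  defines "y \<equiv> 1/4" and "z \<equiv> - (1/2)"
    and "R \<equiv> 2 * sqrt 3 * (2 - sqrt 3)"
  shows "Lauricella_H1 (1/2) (of_real y) (of_real z) =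
    of_real R * Lauricella_G (1/2) (of_real y) (of_real z)"
proof (rule Lauricella_H1_eq_G[where a = "3" and l = 3 and s = "sqrt 3"
      and b = "- 12"])
  show "y * (1 + 3) = 1" "z * (1 - 3) = 1"
    by (simp_all add: y_def z_def field_simps sqrt_mult_sqrt_mult)
  have "sqrt 3 \<le> (2 :: real)" by (rule real_le_lsqrt) auto
  then show "0 \<le> R" by (simp add: R_def)
  show "R\<^sup>2 * (sqrt 3 + 1)\<^sup>2 = 4 * 3 * (sqrt 3 - 1)\<^sup>2"
    by (simp add: R_def sqrt_ring_simps)
  \<comment> \<open>The isogeny is rational with multiplier 1 and ends on the target curve scaled by
    3; undoing the scaling produces \<open>sqrt 3\<close>.\<close>
  show "has_ell_period (4 * 3) (- 12) (sqrt 3 * I)"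
    if "has_ell_period (- (4 * 3)) (- 12) I" for I
    using isogeny_3[of I] that has_ell_period_scale[of 3 "-12" 12] by simp
qed simp_all

lemma Lauricella_order_5:
  fixes y z R :: real
  defines "y \<equiv> (3 - sqrt 5) / 2" and "z \<equiv> - ((1 + sqrt 5) / 2)"
    and "R \<equiv> 2 * sqrt (sqrt 5 - 2)"
  shows "Lauricella_H1 (1/2) (of_real y) (of_real z) =
    of_real R * Lauricella_G (1/2) (of_real y) (of_real z)"
proof (rule Lauricella_H1_eq_G[where a = "(1 + sqrt 5) / 2" and l = 1 and s = "sqrt 5"
      and b = "quad 5 2 (- 1)"])
  show "1 < (1 + sqrt 5) / 2"
    by simp
  show "y * (1 + ((1 + sqrt 5) / 2)) = 1" "z * (1 - ((1 + sqrt 5) / 2)) = 1"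
    by (simp_all add: y_def z_def field_simps sqrt_mult_sqrt_mult)
  have "2 \<le> sqrt (5 :: real)" by (rule real_le_rsqrt) auto
  then have R2: "R\<^sup>2 = 4 * (sqrt 5 - 2)" and "0 \<le> R" by (simp_all add: R_def power_mult_distrib)
  then show "0 \<le> R" by simp
  show "R\<^sup>2 * (sqrt 5 + 1)\<^sup>2 = 4 * ((1 + sqrt 5) / 2) * (sqrt 5 - 1)\<^sup>2"
    unfolding R2 by (simp add: sqrt_ring_simps)
  show "(quad 5 2 (- 1)) * ((1 + sqrt 5) / 2) = - (1 * (((1 + sqrt 5) / 2) - 1))\<^sup>2"
    by (simp add: quad_def biquad_def sqrt_ring_simps)
  show "has_ell_period (4 * 1) (quad 5 2 (- 1)) (sqrt 5 * I)"
    if "has_ell_period (- (4 * 1)) (quad 5 2 (- 1)) I" for I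
    using isogeny_5[of I] that by (simp add: quad_rational quad_sqrt)
qed simp_all

lemma Lauricella_order_7:
  fixes y z R :: real
  defines "y \<equiv> 7/16" and "z \<equiv> - (7/2)"
    and "R \<equiv> 2 * (4 - sqrt 7) / sqrt 7"
  shows "Lauricella_H1 (1/2) (of_real y) (of_real z) =
    of_real R * Lauricella_G (1/2) (of_real y) (of_real z)"
proof (rule Lauricella_H1_eq_G[where a = "9/7" and l = 21 and s = "sqrt 7"
      and b = "- 28"])
  show "y * (1 + (9/7)) = 1" "z * (1 - (9/7)) = 1"
    by (simp_all add: y_def z_def field_simps sqrt_mult_sqrt_mult)
  have "sqrt 7 \<le> (4 :: real)" by (rule real_le_lsqrt) auto
  then show "0 \<le> R" by (simp add: R_def)
  show "R\<^sup>2 * (sqrt 7 + 1)\<^sup>2 = 4 * (9/7) * (sqrt 7 - 1)\<^sup>2"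
    by (simp add: R_def power_divide power_mult_distrib) (simp add: sqrt_ring_simps)
  show "has_ell_period (4 * 21) (- 28) (sqrt 7 * I)"
    if "has_ell_period (- (4 * 21)) (- 28) I" for I
    using isogeny_7[of I] that has_ell_period_scale[of 7 "-28" 84] by simp
qed simp_all

lemma Lauricella_order_9:
  fixes y z R :: real
  defines "y \<equiv> 2 * sqrt 3 - 3" and "z \<equiv> - (2 * sqrt 3 + 3)"
    and "R \<equiv> sqrt 2 / root 4 3"
  shows "Lauricella_H1 (1/2) (of_real y) (of_real z) =
    of_real R * Lauricella_G (1/2) (of_real y) (of_real z)"
proof (rule Lauricella_H1_eq_G[where a = "2 * sqrt 3 / 3" and l = 6 and s = "3"
      and b = "quad 3 72 (- 42)"])
  show "1 < 2 * sqrt 3 / 3"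
    using real_less_rsqrt[of "3/2" 3] by (simp add: power2_eq_square)
  show "y * (1 + (2 * sqrt 3 / 3)) = 1" "z * (1 - (2 * sqrt 3 / 3)) = 1"
    by (simp_all add: y_def z_def field_simps sqrt_mult_sqrt_mult)
  have R2: "R\<^sup>2 = 2 / sqrt 3" by (simp add: R_def power_divide root_4_eq)
  show "0 \<le> R" by (simp add: R_def root_4_eq)
  show "R\<^sup>2 * (3 + 1)\<^sup>2 = 4 * (2 * sqrt 3 / 3) * (3 - 1)\<^sup>2"
    unfolding R2 by (simp add: field_simps)
  show "(quad 3 72 (- 42)) * (2 * sqrt 3 / 3) = - (6 * ((2 * sqrt 3 / 3) - 1))\<^sup>2"
    by (simp add: quad_def biquad_def sqrt_ring_simps)
  show "has_ell_period (4 * 6) (quad 3 72 (- 42)) (3 * I)"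
    if "has_ell_period (- (4 * 6)) (quad 3 72 (- 42)) I" for I
    using isogeny_9_second[OF isogeny_9_first[of I]] that
    by (simp add: quad_rational quad_sqrt sqrt_mult_sqrt_mult)
qed simp_all

lemma Lauricella_order_13:
  fixes y z R :: real
  defines "y \<equiv> (19 - 5 * sqrt 13) / 2" and "z \<equiv> - ((17 + 5 * sqrt 13) / 2)"
    and "R \<equiv> 2 * sqrt (37 * sqrt 13 - 106) / 9"
  shows "Lauricella_H1 (1/2) (of_real y) (of_real z) =
    of_real R * Lauricella_G (1/2) (of_real y) (of_real z)"
proof (rule Lauricella_H1_eq_G[where a = "(1 + 5 * sqrt 13) / 18" and l = 3 and s = "sqrt 13"
      and b = "quad 13 18 (- 5)"])
  show "1 < (1 + 5 * sqrt 13) / 18"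
    using real_less_rsqrt[of "17/5" 13] by (simp add: power2_eq_square)
  show "y * (1 + ((1 + 5 * sqrt 13) / 18)) = 1" "z * (1 - ((1 + 5 * sqrt 13) / 18)) = 1"
    by (simp_all add: y_def z_def field_simps sqrt_mult_sqrt_mult)
  have "106 / 37 \<le> sqrt (13 :: real)" by (rule real_le_rsqrt) (simp add: power2_eq_square)
  then have R2: "R\<^sup>2 = 4 * (37 * sqrt 13 - 106) / 81" and "0 \<le> R"
    by (simp_all add: R_def power_mult_distrib power_divide)
  then show "0 \<le> R" by simp
  show "R\<^sup>2 * (sqrt 13 + 1)\<^sup>2 = 4 * ((1 + 5 * sqrt 13) / 18) * (sqrt 13 - 1)\<^sup>2"
    unfolding R2 by (simp add: sqrt_ring_simps)
  show "(quad 13 18 (- 5)) * ((1 + 5 * sqrt 13) / 18) = - (3 * (((1 + 5 * sqrt 13) / 18) - 1))\<^sup>2"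
    by (simp add: quad_def biquad_def sqrt_ring_simps)
  show "has_ell_period (4 * 3) (quad 13 18 (- 5)) (sqrt 13 * I)"
    if "has_ell_period (- (4 * 3)) (quad 13 18 (- 5)) I" for I
    using isogeny_13[of I] that by (simp add: quad_rational quad_sqrt)
qed simp_all

lemma Lauricella_order_15:
  fixes y z R :: real
  defines "y \<equiv> 3/32 * (3 + sqrt 5)" and "z \<equiv> - (3/2 * (9 + 4 * sqrt 5))"
    and "R \<equiv> 2 * (sqrt 3 - 3 * sqrt 5) * (sqrt 5 - 4) / (3 * (1 + sqrt 15))"
  shows "Lauricella_H1 (1/2) (of_real y) (of_real z) =
    of_real R * Lauricella_G (1/2) (of_real y) (of_real z)"
proof (rule Lauricella_H1_eq_G[where a = "7 - 8 * sqrt 5 / 3" and l = 33 and s = "sqrt 15"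
      and b = "quad 5 (- 6012) 2688"])
  show "1 < 7 - 8 * sqrt 5 / 3"
    using real_less_lsqrt[of "9/4" 5] by (simp add: power2_eq_square)
  show "y * (1 + (7 - 8 * sqrt 5 / 3)) = 1" "z * (1 - (7 - 8 * sqrt 5 / 3)) = 1"
    by (simp_all add: y_def z_def field_simps sqrt_mult_sqrt_mult)
  have s15: "sqrt 15 = sqrt 3 * sqrt 5" by (simp flip: real_sqrt_mult)
  have "sqrt 3 \<le> sqrt (5 :: real)" "sqrt 5 \<le> (4 :: real)" by (auto intro: real_le_lsqrt)
  moreover have "0 \<le> sqrt (5 :: real)" by simp
  ultimately have "sqrt 3 - 3 * sqrt 5 \<le> 0" "sqrt 5 - 4 \<le> (0 :: real)" by linarith+
  then show "0 \<le> R"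
    unfolding R_def by (intro divide_nonneg_nonneg) (auto simp: mult.assoc intro: mult_nonpos_nonpos)
  \<comment> \<open>Hiding the denominator lets it cancel before \<open>sqrt 15\<close> is split
    into \<open>sqrt 3 * sqrt 5\<close>.\<close>
  define w where "w = 1 + sqrt (15 :: real)"
  have w: "1 + sqrt 15 = w" "sqrt 15 + 1 = w" and "0 < w"
    by (simp_all add: w_def add_pos_nonneg)
  then have "(R * (sqrt 15 + 1))\<^sup>2 = (2 * (sqrt 3 - 3 * sqrt 5) * (sqrt 5 - 4) / 3)\<^sup>2"
    unfolding R_def w by simp
  also have "\<dots> = 4 * (7 - 8 * sqrt 5 / 3) * (sqrt 15 - 1)\<^sup>2"
    unfolding s15 by (simp add: sqrt_ring_simps)
  finally show "R\<^sup>2 * (sqrt 15 + 1)\<^sup>2 = 4 * (7 - 8 * sqrt 5 / 3) * (sqrt 15 - 1)\<^sup>2"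
    by (simp add: power_mult_distrib)
  show "(quad 5 (- 6012) 2688) * (7 - 8 * sqrt 5 / 3) = - (33 * ((7 - 8 * sqrt 5 / 3) - 1))\<^sup>2"
    by (simp add: quad_def biquad_def sqrt_ring_simps)
  show "has_ell_period (4 * 33) (quad 5 (- 6012) 2688) (sqrt 15 * I)"
    if "has_ell_period (- (4 * 33)) (quad 5 (- 6012) 2688) I" for I
  proof -
    \<comment> \<open>Scaling by 5 absorbs the multiplier \<open>sqrt 5\<close>. After the second
      isogeny the curve is the target scaled by 15, which returns \<open>sqrt 15\<close>.\<close>
    have "has_ell_period (5 * quad 5 348 (- 144)) (5\<^sup>2 * quad 5 (- 252) (- 96)) I"
      using isogeny_15_first[of I] that
      by (subst has_ell_period_scale) (simp_all add: quad_rational quad_sqrt quad_signs)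
    then have "has_ell_period (15 * 132) (15\<^sup>2 * quad 5 (- 6012) 2688) I"
      using isogeny_15_second[of I] by (simp add: quad_simps quad_rational)
    then show ?thesis
      by (subst (asm) has_ell_period_scale) (simp_all add: quad_signs)
  qed
qed simp_all

lemma Lauricella_order_25:
  fixes y z R :: real
  defines "y \<equiv> 4 * (9 * sqrt 5 - 20)" and "z \<equiv> - (4 * (20 + 9 * sqrt 5))"
    and "R \<equiv> 2 / root 4 5"
  shows "Lauricella_H1 (1/2) (of_real y) (of_real z) =
    of_real R * Lauricella_G (1/2) (of_real y) (of_real z)"
proof (rule Lauricella_H1_eq_G[where a = "9 * sqrt 5 / 20" and l = 30 and s = "5"
      and b = "quad 5 1800 (- 805)"])
  show "1 < 9 * sqrt 5 / 20"
    using real_less_rsqrt[of "20/9" 5] by (simp add: power2_eq_square)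
  show "y * (1 + (9 * sqrt 5 / 20)) = 1" "z * (1 - (9 * sqrt 5 / 20)) = 1"
    by (simp_all add: y_def z_def field_simps sqrt_mult_sqrt_mult)
  have R2: "R\<^sup>2 = 4 / sqrt 5" by (simp add: R_def power_divide root_4_eq)
  show "0 \<le> R" by (simp add: R_def root_4_eq)
  show "R\<^sup>2 * (5 + 1)\<^sup>2 = 4 * (9 * sqrt 5 / 20) * (5 - 1)\<^sup>2"
    unfolding R2 by (simp add: field_simps)
  show "(quad 5 1800 (- 805)) * (9 * sqrt 5 / 20) = - (30 * ((9 * sqrt 5 / 20) - 1))\<^sup>2"
    by (simp add: quad_def biquad_def sqrt_ring_simps)
  show "has_ell_period (4 * 30) (quad 5 1800 (- 805)) (5 * I)"
    if "has_ell_period (- (4 * 30)) (quad 5 1800 (- 805)) I" for I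
    using isogeny_25_second[OF isogeny_25_first[of I]] that
    by (simp add: quad_rational quad_sqrt sqrt_mult_sqrt_mult)
qed simp_all

lemma Lauricella_order_33:
  fixes y z R :: real
  defines "y \<equiv> 16 / (16 + 15 * sqrt 3 - 3 * sqrt 11)" and "z \<equiv> 16 / (16 - 15 * sqrt 3 + 3 * sqrt 11)"
    and "R \<equiv> sqrt 3 * (17 - sqrt 33) * root 4 (43 - 5 * sqrt 33) / 2 powr (19/4)"
  shows "Lauricella_H1 (1/2) (of_real y) (of_real z) =
    of_real R * Lauricella_G (1/2) (of_real y) (of_real z)"
proof (rule Lauricella_H1_eq_G[where a = "(15 * sqrt 3 - 3 * sqrt 11) / 16" and l = 12 and s = "sqrt 33"
      and b = "biquad 3 11 288 (- 195) 15 0"])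
  have s33: "sqrt 33 = sqrt 3 * sqrt 11" by (simp flip: real_sqrt_mult)
  \<comment> \<open>Three decimals are needed, since \<open>15 * sqrt 3 - 3 * sqrt 11\<close>
    exceeds 16 only by about 0.03.\<close>
  have approx: "1.732 < sqrt (3 :: real)" "sqrt 11 < (3.317 :: real)"
    using real_less_rsqrt[of "1.732" 3] real_less_lsqrt[of "3.317" 11]
    by (simp_all add: power2_eq_square)
  show "1 < (15 * sqrt 3 - 3 * sqrt 11) / 16"
    using approx by simp
  show "y * (1 + ((15 * sqrt 3 - 3 * sqrt 11) / 16)) = 1" "z * (1 - ((15 * sqrt 3 - 3 * sqrt 11) / 16)) = 1"
    using approx by (auto simp: y_def z_def field_simps)
  have "0 \<le> 5 * sqrt 3 - sqrt (11 :: real)" using approx by simp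
  moreover have "((5 * sqrt 3 - sqrt 11) / sqrt 2)\<^sup>2 = 43 - 5 * sqrt 33"
    unfolding s33 by (simp add: power_divide) (simp add: sqrt_ring_simps)
  \<comment> \<open>Denesting the radical gives a multiple of \<open>a\<close>, namely
    \<open>5 * sqrt 3 - sqrt 11\<close>, over \<open>sqrt 2\<close>. That \<open>sqrt 2\<close>
    combines with the half-integral power of 2 in the square of \<open>R\<close> to the rational
    denominator 1024.\<close>
  ultimately have root: "sqrt (43 - 5 * sqrt 33) = (5 * sqrt 3 - sqrt 11) / sqrt 2"
    by (intro real_sqrt_unique) auto
  have "(2 powr (19/4))\<^sup>2 = (2 :: real) powr (9 + 1/2)"
    by (simp add: powr_power)
  also have "\<dots> = 512 * sqrt 2"
    by (subst powr_add) (simp add: powr_half_sqrt)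
  finally have powr: "(2 powr (19/4))\<^sup>2 = 512 * sqrt (2 :: real)" .
  have "sqrt 33 \<le> (17 :: real)" "sqrt 33 \<le> (43/5 :: real)"
    by (rule real_le_lsqrt; simp add: power2_eq_square)+
  then have nonneg: "0 \<le> 17 - sqrt (33 :: real)" "0 \<le> 43 - 5 * sqrt (33 :: real)"
    by simp_all
  then show "0 \<le> R"
    by (simp add: R_def root_4_eq)
  have "R\<^sup>2 = 3 * (17 - sqrt 33)\<^sup>2 * sqrt (43 - 5 * sqrt 33) / (512 * sqrt 2)"
    using nonneg by (simp add: R_def power_divide power_mult_distrib powr root_4_eq)
  also have "\<dots> = 3 * (17 - sqrt 33)\<^sup>2 * (5 * sqrt 3 - sqrt 11) / 1024"
    unfolding root by simp
  finally have R2: "R\<^sup>2 = 3 * (17 - sqrt 33)\<^sup>2 * (5 * sqrt 3 - sqrt 11) / 1024" .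
  show "R\<^sup>2 * (sqrt 33 + 1)\<^sup>2 = 4 * ((15 * sqrt 3 - 3 * sqrt 11) / 16) * (sqrt 33 - 1)\<^sup>2"
    unfolding R2 s33 by (simp add: sqrt_ring_simps)
  show "(biquad 3 11 288 (- 195) 15 0) * ((15 * sqrt 3 - 3 * sqrt 11) / 16) = - (12 * (((15 * sqrt 3 - 3 * sqrt 11) / 16) - 1))\<^sup>2"
    by (simp add: quad_def biquad_def sqrt_ring_simps)
  show "has_ell_period (4 * 12) (biquad 3 11 288 (- 195) 15 0) (sqrt 33 * I)"
    if "has_ell_period (- (4 * 12)) (biquad 3 11 288 (- 195) 15 0) I" for I
  proof -
    \<comment> \<open>Scaling by 11 absorbs \<open>sqrt 11\<close>, and undoing it after the second
      isogeny restores this factor beside \<open>sqrt 3\<close>.\<close>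
    have "has_ell_period (11 * biquad 3 11 84 0 0 (- 12))
        (11\<^sup>2 * biquad 3 11 1476 (- 855) 435 (- 252)) I"
      using isogeny_33_first[of I] that
      by (subst has_ell_period_scale) (simp_all add: biquad_rational biquad_sqrt quad_simps quad_signs)
    then have "has_ell_period (11 * 48) (11\<^sup>2 * biquad 3 11 288 (- 195) 15 0) (sqrt 3 * I)"
      using isogeny_33_second[of I] by (simp add: quad_simps biquad_rational biquad_sqrt)
    then show ?thesis
      unfolding s33 by (subst (asm) has_ell_period_scale) (simp_all add: quad_simps quad_signs ac_simps)
  qed
qed simp_all

theorem mainTheorem4:
  shows
    "(let y = 1/4 :: real;
          z = - (1/2) :: real;
          R = 2 * sqrt 3 * (2 - sqrt 3) :: real
      in Lauricella_H1 (1/2) (complex_of_real y) (complex_of_real z) =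
         complex_of_real R * Lauricella_G (1/2) (complex_of_real y) (complex_of_real z)) \<and>
     (let y = (3 - sqrt 5) / 2 :: real;
          z = - ((1 + sqrt 5) / 2) :: real;
          R = 2 * sqrt (sqrt 5 - 2) :: real
      in Lauricella_H1 (1/2) (complex_of_real y) (complex_of_real z) =
         complex_of_real R * Lauricella_G (1/2) (complex_of_real y) (complex_of_real z)) \<and>
     (let y = 7/16 :: real;
          z = - (7/2) :: real;
          R = 2 * (4 - sqrt 7) / sqrt 7 :: real
      in Lauricella_H1 (1/2) (complex_of_real y) (complex_of_real z) =
         complex_of_real R * Lauricella_G (1/2) (complex_of_real y) (complex_of_real z)) \<and>
     (let y = 2 * sqrt 3 - 3 :: real;
          z = - (2 * sqrt 3 + 3) :: real;
          R = sqrt 2 / root 4 3 :: real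
      in Lauricella_H1 (1/2) (complex_of_real y) (complex_of_real z) =
         complex_of_real R * Lauricella_G (1/2) (complex_of_real y) (complex_of_real z)) \<and>
     (let y = (19 - 5 * sqrt 13) / 2 :: real;
          z = - ((17 + 5 * sqrt 13) / 2) :: real;
          R = 2 * sqrt (37 * sqrt 13 - 106) / 9 :: real
      in Lauricella_H1 (1/2) (complex_of_real y) (complex_of_real z) =
         complex_of_real R * Lauricella_G (1/2) (complex_of_real y) (complex_of_real z)) \<and>
     (let y = 3/32 * (3 + sqrt 5) :: real;
          z = - (3/2 * (9 + 4 * sqrt 5)) :: real;
          R = 2 * (sqrt 3 - 3 * sqrt 5) * (sqrt 5 - 4) / (3 * (1 + sqrt 15)) :: real
      in Lauricella_H1 (1/2) (complex_of_real y) (complex_of_real z) =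
         complex_of_real R * Lauricella_G (1/2) (complex_of_real y) (complex_of_real z)) \<and>
     (let y = 4 * (9 * sqrt 5 - 20) :: real;
          z = - (4 * (20 + 9 * sqrt 5)) :: real;
          R = 2 / root 4 5 :: real
      in Lauricella_H1 (1/2) (complex_of_real y) (complex_of_real z) =
         complex_of_real R * Lauricella_G (1/2) (complex_of_real y) (complex_of_real z)) \<and>
     (let y = 16 / (16 + 15 * sqrt 3 - 3 * sqrt 11) :: real;
          z = 16 / (16 - 15 * sqrt 3 + 3 * sqrt 11) :: real;
          R = sqrt 3 * (17 - sqrt 33) * root 4 (43 - 5 * sqrt 33) / 2 powr (19/4) :: real
      in Lauricella_H1 (1/2) (complex_of_real y) (complex_of_real z) =
         complex_of_real R * Lauricella_G (1/2) (complex_of_real y) (complex_of_real z))"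
  unfolding Let_def
  by (intro conjI Lauricella_order_3 Lauricella_order_5 Lauricella_order_7 Lauricella_order_9
      Lauricella_order_13 Lauricella_order_15 Lauricella_order_25 Lauricella_order_33)

end
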